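(* Let $N\in\{3,4\}$, $2^*=\frac{2N}{N-2}$, $a,b>0$, and $\alpha>1$, $\beta>1$ with $\alpha+\beta<2^*$. If $\nu\le 0$, then the infimum $$m_\nu(a,b)=\inf_{(u,v)\in\mathcal P_\nu(a,b)} I_\nu(u,v)$$ is not achieved, i.e. there is no $(u,v)\in\mathcal P_\nu(a,b)$ with $I_\nu(u,v)=m_\nu(a,b)$.
   Context: $H=H^1(\mathbb R^N)\times H^1(\mathbb R^N)$, $\gamma:=\frac{N(\alpha+\beta-2)}{2}$. For $\nu\in\mathbb R$ and $(u,v)\in H$, $I_\nu(u,v)=\frac12\int_{\mathbb R^N}(|\nabla u|^2+|\nabla v|^2)-\frac1{2^*}\int_{\mathbb R^N}(|u|^{2^*}+|v|^{2^*})-\nu\int_{\mathbb R^N}|u|^\alpha|v|^\beta$, $P_\nu(u,v)=\int(|\nabla u|^2+|\nabla v|^2)-\int(|u|^{2^*}+|v|^{2^*})-\nu\gamma\int|u|^\alpha|v|^\beta$. $\mathcal T(a,b)=\{(u,v)\in H:\|u\|_2=a,\ \|v\|_2=b\}$ and $\mathcal P_\nu(a,b)=\{(u,v)\in\mathcal T(a,b):P_\nu(u,v)=0\}$. *)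

theory Defs
  imports "HOL-Analysis.Analysis"
begin

definition pderiv_i :: "'n::finite \<Rightarrow> (real^'n \<Rightarrow> real) \<Rightarrow> real^'n \<Rightarrow> real" where
  "pderiv_i i f x = frechet_derivative f (at x) (axis i 1)"

fun Ck :: "nat \<Rightarrow> (real^'n::finite \<Rightarrow> real) set" where
  "Ck 0 = {f. continuous_on UNIV f}"
| "Ck (Suc k) = {f. continuous_on UNIV f \<and> f differentiable_on UNIV \<and>
                    (\<forall>i. pderiv_i i f \<in> Ck k)}"

definition test_fun :: "(real^'n::finite \<Rightarrow> real) \<Rightarrow> bool" where
  "test_fun \<phi> \<longleftrightarrow> (\<forall>k. \<phi> \<in> Ck k) \<and> compact (closure {x. \<phi> x \<noteq> 0})"

definition weak_grad :: "(real^'n::finite \<Rightarrow> real) \<Rightarrow> (real^'n \<Rightarrow> real^'n) \<Rightarrow> bool" where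
  "weak_grad u G \<longleftrightarrow> (\<forall>\<phi> i. test_fun \<phi> \<longrightarrow>
      integral\<^sup>L lebesgue (\<lambda>x. u x * pderiv_i i \<phi> x)
      = - integral\<^sup>L lebesgue (\<lambda>x. G x $ i * \<phi> x))"

definition L2 :: "(real^'n::finite \<Rightarrow> real) \<Rightarrow> bool" where
  "L2 u \<longleftrightarrow> u \<in> borel_measurable lebesgue \<and> integrable lebesgue (\<lambda>x. (u x)\<^sup>2)"

definition L2_grad :: "(real^'n::finite \<Rightarrow> real) \<Rightarrow> (real^'n \<Rightarrow> real^'n) \<Rightarrow> bool" where
  "L2_grad u G \<longleftrightarrow> (\<forall>i. L2 (\<lambda>x. G x $ i)) \<and> weak_grad u G"

definition H1 :: "(real^'n::finite \<Rightarrow> real) set" where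
  "H1 = {u. L2 u \<and> (\<exists>G. L2_grad u G)}"

text \<open>The weak gradient (unique a.e., so integrals of it are well defined).\<close>
definition grad :: "(real^'n::finite \<Rightarrow> real) \<Rightarrow> real^'n \<Rightarrow> real^'n" where
  "grad u = (SOME G. L2_grad u G)"

definition L2norm :: "(real^'n::finite \<Rightarrow> real) \<Rightarrow> real" where
  "L2norm u = sqrt (integral\<^sup>L lebesgue (\<lambda>x. (u x)\<^sup>2))"

definition dirichlet :: "(real^'n::finite \<Rightarrow> real) \<Rightarrow> real" where
  "dirichlet u = integral\<^sup>L lebesgue (\<lambda>x. (norm (grad u x))\<^sup>2)"

definition crit_exp :: "'n::finite itself \<Rightarrow> real" where
  "crit_exp _ = 2 * real CARD('n) / (real CARD('n) - 2)"

definition gamma_ab :: "'n::finite itself \<Rightarrow> real \<Rightarrow> real \<Rightarrow> real" where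
  "gamma_ab _ \<alpha> \<beta> = real CARD('n) * (\<alpha> + \<beta> - 2) / 2"

definition Lp_pow :: "real \<Rightarrow> (real^'n::finite \<Rightarrow> real) \<Rightarrow> real" where
  "Lp_pow p u = integral\<^sup>L lebesgue (\<lambda>x. \<bar>u x\<bar> powr p)"

definition coupling :: "real \<Rightarrow> real \<Rightarrow> (real^'n::finite \<Rightarrow> real) \<Rightarrow> (real^'n \<Rightarrow> real) \<Rightarrow> real" where
  "coupling \<alpha> \<beta> u v = integral\<^sup>L lebesgue (\<lambda>x. \<bar>u x\<bar> powr \<alpha> * \<bar>v x\<bar> powr \<beta>)"

definition I_nu :: "real \<Rightarrow> real \<Rightarrow> real \<Rightarrow> (real^'n::finite \<Rightarrow> real) \<Rightarrow> (real^'n \<Rightarrow> real) \<Rightarrow> real" where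
  "I_nu \<alpha> \<beta> \<nu> u v =
     (1/2) * (dirichlet u + dirichlet v)
     - (1 / crit_exp TYPE('n)) * (Lp_pow (crit_exp TYPE('n)) u + Lp_pow (crit_exp TYPE('n)) v)
     - \<nu> * coupling \<alpha> \<beta> u v"

definition P_nu :: "real \<Rightarrow> real \<Rightarrow> real \<Rightarrow> (real^'n::finite \<Rightarrow> real) \<Rightarrow> (real^'n \<Rightarrow> real) \<Rightarrow> real" where
  "P_nu \<alpha> \<beta> \<nu> u v =
     (dirichlet u + dirichlet v)
     - (Lp_pow (crit_exp TYPE('n)) u + Lp_pow (crit_exp TYPE('n)) v)
     - \<nu> * gamma_ab TYPE('n) \<alpha> \<beta> * coupling \<alpha> \<beta> u v"

definition T_set :: "real \<Rightarrow> real \<Rightarrow> ((real^'n::finite \<Rightarrow> real) \<times> (real^'n \<Rightarrow> real)) set" where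
  "T_set a b = {(u, v). u \<in> H1 \<and> v \<in> H1 \<and> L2norm u = a \<and> L2norm v = b}"

definition Pohozaev_set :: "real \<Rightarrow> real \<Rightarrow> real \<Rightarrow> real \<Rightarrow> real \<Rightarrow>
    ((real^'n::finite \<Rightarrow> real) \<times> (real^'n \<Rightarrow> real)) set" where
  "Pohozaev_set \<alpha> \<beta> \<nu> a b = {(u, v) \<in> T_set a b. P_nu \<alpha> \<beta> \<nu> u v = 0}"

text \<open>m_nu(a,b) as an infimum in the extended reals (always well defined).\<close>
definition m_nu :: "'n::finite itself \<Rightarrow> real \<Rightarrow> real \<Rightarrow> real \<Rightarrow> real \<Rightarrow> real \<Rightarrow> ereal" where
  "m_nu _ \<alpha> \<beta> \<nu> a b =
     (INF p \<in> (Pohozaev_set \<alpha> \<beta> \<nu> a b :: ((real^'n \<Rightarrow> real) \<times> (real^'n \<Rightarrow> real)) set).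
        ereal (I_nu \<alpha> \<beta> \<nu> (fst p) (snd p)))"

end

theory Submission
  imports Defs
begin

text \<open>
  On the Pohozaev set, with \<open>D = \<parallel>\<nabla>u\<parallel>\<^sup>2 + \<parallel>\<nabla>v\<parallel>\<^sup>2\<close>, the energy equals \<open>D/N\<close> plus a nonnegative multiple
  of the coupling, and for \<open>\<nu> \<le> 0\<close> the constraint gives \<open>D \<le> L u + L v\<close>, where \<open>L\<close> is the critical power
  integral. The quotient \<open>K w = L w / \<parallel>\<nabla>w\<parallel>\<^bsup>2*\<^esup>\<close> is invariant under amplitude changes
  and dilations. If \<open>w\<close> is the component of a supposed minimizer with the larger quotient, strict
  superadditivity of \<open>x \<mapsto> x\<^bsup>2*/2\<^esup>\<close> gives \<open>D > d\<close>, where \<open>d\<close> is the positive solution of \<open>d = K w d\<^bsup>2*/2\<^esup>\<close>.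
  On the other hand, taking both components to be rescaled copies of \<open>w\<close>, the first with Dirichlet
  energy \<open>d\<close> and the second spread out so far that its energy and the coupling are negligible, and
  projecting the pair onto the Pohozaev set by a common dilation, one gets energies arbitrarily close to
  \<open>d/N < D/N\<close>. So the Sobolev inequality and its extremals are not needed: the minimizer supplies its
  own competitor.
\<close>

section \<open>Smooth functions with compact support\<close>

text \<open>For \<open>k = 0\<close> this is the classical flat function exp(-1/s). The powers of
  1/s are included because differentiation then stays within linear combinations of the
  family.\<close>

definition exp_bump :: "nat \<Rightarrow> real \<Rightarrow> real" where
  "exp_bump k s = (if s > 0 then exp (- inverse s) * inverse s ^ k else 0)"

text \<open>From the right, substituting y = 1/s turns the function into y^k / exp y, which tends to
  0 at infinity.\<close>

lemma tendsto_exp_bump_at_0: "(exp_bump k \<longlongrightarrow> 0) (at 0)"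
proof (rule filterlim_split_at)
  show "(exp_bump k \<longlongrightarrow> 0) (at_left 0)"
    by (rule tendsto_eventually) (auto simp: exp_bump_def eventually_at_filter)
  have "((\<lambda>s. (\<lambda>x. x ^ k / exp x) (inverse s)) \<longlongrightarrow> (0::real)) (at_right 0)"
    by (rule filterlim_compose[OF tendsto_power_div_exp_0 filterlim_inverse_at_top_right])
  then show "(exp_bump k \<longlongrightarrow> 0) (at_right 0)"
    by (rule Lim_transform_eventually)
      (auto simp: exp_bump_def eventually_at_filter exp_minus field_simps)
qed

lemma exp_bump_has_real_derivative:
  "(exp_bump k has_real_derivative exp_bump (k + 2) s - real k * exp_bump (k + 1) s) (at s)"
proof (cases s "0 :: real" rule: linorder_cases)
  case less
  have "((\<lambda>s. 0) has_real_derivative 0) (at s)" by simp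
  then have "(exp_bump k has_real_derivative 0) (at s)"
    by (rule DERIV_cong_ev[THEN iffD1, rotated -1, OF _ refl _ refl])
      (use less in \<open>auto simp: exp_bump_def eventually_nhds intro!: exI[of _ "{..<0}"]\<close>)
  with less show ?thesis by (simp add: exp_bump_def)
next
  case equal
  \<comment> \<open>The difference quotient of \<open>exp_bump k\<close> at 0 is
    \<open>exp_bump (Suc k)\<close>, so flatness one index higher gives the derivative 0.\<close>
  have "((\<lambda>h. exp_bump (Suc k) h) \<longlongrightarrow> 0) (at 0)"
    by (rule tendsto_exp_bump_at_0)
  then have "((\<lambda>h. (exp_bump k (0 + h) - exp_bump k 0) / h) \<longlongrightarrow> 0) (at 0)"
    by (rule Lim_transform_eventually)
      (auto simp: exp_bump_def eventually_at_filter field_simps)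
  with equal show ?thesis by (simp add: DERIV_def exp_bump_def)
next
  case greater
  define D where "D = exp (- inverse s) * inverse s ^ (k + 2) - real k * (exp (- inverse s) * inverse s ^ (k + 1))"
  have "((\<lambda>s. exp (- inverse s) * inverse s ^ k) has_real_derivative D) (at s)"
    unfolding D_def using greater
    by (auto intro!: derivative_eq_intros simp: power2_eq_square)
       (cases k; simp add: field_simps power2_eq_square)
  then have "(exp_bump k has_real_derivative D) (at s)"
    by (rule DERIV_cong_ev[THEN iffD1, rotated -1, OF _ refl _ refl])
      (use greater in \<open>auto simp: exp_bump_def eventually_nhds intro!: exI[of _ "{0<..}"]\<close>)
  with greater show ?thesis by (simp add: exp_bump_def D_def)
qed

section \<open>Smoothness of all orders and box-shaped bumps\<close>

lemma pderiv_i_eqI: "(f has_derivative f') (at x) \<Longrightarrow> pderiv_i i f x = f' (axis i 1)"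
  unfolding pderiv_i_def by (simp add: frechet_derivative_at[symmetric])

text \<open>A class of differentiable functions closed under partial derivatives lies in every
  \<open>Ck k\<close>. Smoothness thus reduces to finding such a class, with no formulas for higher
  derivatives.\<close>

lemma Ck_coinduct:
  fixes f :: "real^'n::finite \<Rightarrow> real"
  assumes "f \<in> S"
    and diff: "\<And>g x. g \<in> S \<Longrightarrow> g differentiable (at x)"
    and step: "\<And>g i. g \<in> S \<Longrightarrow> pderiv_i i g \<in> S"
  shows "f \<in> Ck k"
  using assms(1)
proof (induction k arbitrary: f)
  case 0
  then show ?case
    using diff by (auto intro!: continuous_at_imp_continuous_on differentiable_imp_continuous_within)
next
  case (Suc k)
  then show ?case
    using diff step
    by (auto simp: differentiable_on_def
        intro!: continuous_at_imp_continuous_on differentiable_imp_continuous_within)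
qed

text \<open>This serves as the closed class in \<open>Ck_coinduct\<close>. Sums and products are
  present because the chain and product rules produce them. The affine arguments allow a cutoff on
  either side of a coordinate.\<close>

inductive_set bump_alg :: "(real^'n::finite \<Rightarrow> real) set" where
  const: "(\<lambda>x. c) \<in> bump_alg"
| bump: "(\<lambda>x. exp_bump k (c * x $ i + d)) \<in> bump_alg"
| add: "f \<in> bump_alg \<Longrightarrow> g \<in> bump_alg \<Longrightarrow> (\<lambda>x. f x + g x) \<in> bump_alg"
| mult: "f \<in> bump_alg \<Longrightarrow> g \<in> bump_alg \<Longrightarrow> (\<lambda>x. f x * g x) \<in> bump_alg"

lemma bump_alg_prod:
  "finite I \<Longrightarrow> (\<And>i. i \<in> I \<Longrightarrow> f i \<in> bump_alg) \<Longrightarrow> (\<lambda>x. \<Prod>i\<in>I. f i x) \<in> bump_alg"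
  by (induction I rule: finite_induct) (auto intro: bump_alg.intros)

lemma bump_alg_derivative:
  fixes f :: "real^'n::finite \<Rightarrow> real"
  assumes "f \<in> bump_alg"
  shows "(\<forall>x. f differentiable (at x)) \<and> (\<forall>i. pderiv_i i f \<in> bump_alg)"
  using assms
proof induction
  case (const c)
  have "pderiv_i i (\<lambda>x::real^'n. c) = (\<lambda>x. 0)" for i
    by (rule ext, subst pderiv_i_eqI[OF has_derivative_const]) simp
  then show ?case by (auto intro: bump_alg.const)
next
  case (bump k c i d)
  have D: "((\<lambda>x. exp_bump k (c * x $ i + d)) has_derivative
      (\<lambda>h. (exp_bump (k + 2) (c * x $ i + d) - real k * exp_bump (k + 1) (c * x $ i + d)) * (c * h $ i))) (at x)"
    for x :: "real^'n"
    by (rule DERIV_compose_FDERIV[OF exp_bump_has_real_derivative, THEN has_derivative_eq_rhs])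
      (auto intro!: derivative_eq_intros bounded_linear.has_derivative[OF bounded_linear_vec_nth])
  have "(\<lambda>x. (exp_bump (k + 2) (c * x $ i + d) + (- real k) * exp_bump (k + 1) (c * x $ i + d)) * (c * axis j 1 $ i)) \<in> bump_alg" for j :: 'n
    by (intro bump_alg.intros)
  moreover have "pderiv_i j (\<lambda>x. exp_bump k (c * x $ i + d)) =
     (\<lambda>x. (exp_bump (k + 2) (c * x $ i + d) + (- real k) * exp_bump (k + 1) (c * x $ i + d)) * (c * axis j 1 $ i))" for j
    by (rule ext, subst pderiv_i_eqI[OF D]) simp
  ultimately show ?case using D by (auto simp: differentiable_def)
next
  case (add f g)
  have D: "((\<lambda>x. f x + g x) has_derivative (\<lambda>h. frechet_derivative f (at x) h + frechet_derivative g (at x) h)) (at x)" for x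
    using add by (intro has_derivative_add) (auto simp: frechet_derivative_works)
  have "pderiv_i i (\<lambda>x. f x + g x) = (\<lambda>x. pderiv_i i f x + pderiv_i i g x)" for i
    by (rule ext, subst pderiv_i_eqI[OF D]) (simp add: pderiv_i_def)
  then show ?case using add D by (auto simp: differentiable_def intro: bump_alg.add)
next
  case (mult f g)
  have D: "((\<lambda>x. f x * g x) has_derivative (\<lambda>h. f x * frechet_derivative g (at x) h + frechet_derivative f (at x) h * g x)) (at x)" for x
    using mult by (intro has_derivative_mult) (auto simp: frechet_derivative_works)
  have "pderiv_i i (\<lambda>x. f x * g x) = (\<lambda>x. f x * pderiv_i i g x + pderiv_i i f x * g x)" for i
    by (rule ext, subst pderiv_i_eqI[OF D]) (simp add: pderiv_i_def)
  then show ?case using mult D by (auto simp: differentiable_def intro!: bump_alg.add bump_alg.mult)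
qed

lemma bump_alg_Ck: "f \<in> bump_alg \<Longrightarrow> f \<in> Ck k"
  by (rule Ck_coinduct[of f bump_alg]) (use bump_alg_derivative in auto)

text \<open>Since \<open>exp_bump 0 (r s) = exp (-1/(r s))\<close> tends to 1 as \<open>r \<rightarrow> \<infinity>\<close> for \<open>s > 0\<close>, these products converge to the
  indicator function of the box while staying smooth.\<close>

definition box_bump :: "real^'n::finite \<Rightarrow> real^'n \<Rightarrow> real \<Rightarrow> real^'n \<Rightarrow> real" where
  "box_bump a b r x =
     (\<Prod>i\<in>UNIV. exp_bump 0 (r * x $ i + - (r * a $ i)) * exp_bump 0 (- r * x $ i + r * b $ i))"

lemma exp_bump_0_bounds: "0 \<le> exp_bump 0 s" "exp_bump 0 s \<le> 1"
  by (auto simp: exp_bump_def)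

lemma exp_bump_0_eq_0_iff: "exp_bump 0 s = 0 \<longleftrightarrow> s \<le> 0"
  by (auto simp: exp_bump_def)

lemma box_bump_bounds: "0 \<le> box_bump a b r x" "box_bump a b r x \<le> 1"
  unfolding box_bump_def
  by (auto intro!: prod_nonneg prod_le_1 mult_le_one simp: exp_bump_0_bounds)

lemma box_bump_eq_0_iff:
  assumes "r > 0"
  shows "box_bump a b r x = 0 \<longleftrightarrow> x \<notin> box a b"
proof -
  have "r * x $ i + - (r * a $ i) \<le> 0 \<longleftrightarrow> x $ i \<le> a $ i"
       "- r * x $ i + r * b $ i \<le> 0 \<longleftrightarrow> b $ i \<le> x $ i" for i
    using assms by auto
  then show ?thesis
    by (auto simp: box_bump_def prod_zero_iff exp_bump_0_eq_0_iff mem_box_cart not_less)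
qed

lemma test_fun_box_bump:
  assumes "r > 0"
  shows "test_fun (box_bump a b r)"
proof -
  have "box_bump a b r \<in> bump_alg"
    unfolding box_bump_def [abs_def] by (intro bump_alg_prod bump_alg.mult bump_alg.bump) auto
  moreover have "{x. box_bump a b r x \<noteq> 0} = box a b"
    using box_bump_eq_0_iff[OF assms] by auto
  ultimately show ?thesis
    by (simp add: test_fun_def bump_alg_Ck compact_closure)
qed

lemma tendsto_box_bump:
  fixes a b x :: "real^'n::finite"
  shows "(\<lambda>n. box_bump a b (real (Suc n)) x) \<longlonglongrightarrow> indicator (box a b) x"
proof (cases "x \<in> box a b")
  case False
  then show ?thesis
    by (subst tendsto_cong[where g = "\<lambda>n. 0"]) (auto simp: box_bump_eq_0_iff simp del: of_nat_Suc)
next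
  case True
  have *: "(\<lambda>n. exp_bump 0 (real (Suc n) * s)) \<longlonglongrightarrow> 1" if "s > 0" for s
  proof -
    have "(\<lambda>n. exp (- (inverse (real (Suc n)) * inverse s))) \<longlonglongrightarrow> exp (- (0 * inverse s))"
      by (intro tendsto_intros LIMSEQ_inverse_real_of_nat)
    then show ?thesis
      using that by (simp add: exp_bump_def zero_less_mult_iff del: of_nat_Suc)
  qed
  have "(\<lambda>n. \<Prod>i\<in>UNIV. exp_bump 0 (real (Suc n) * (x $ i - a $ i)) * exp_bump 0 (real (Suc n) * (b $ i - x $ i)))
     \<longlonglongrightarrow> (\<Prod>i\<in>(UNIV :: 'n set). 1 * 1)"
    by (rule tendsto_prod, rule tendsto_mult; rule *) (use True in \<open>auto simp: mem_box_cart\<close>)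
  with True show ?thesis by (simp add: box_bump_def algebra_simps)
qed

section \<open>Operations on test functions\<close>

lemma test_funD: "test_fun f \<Longrightarrow> f differentiable (at x)" "test_fun f \<Longrightarrow> continuous_on UNIV f"
  "test_fun f \<Longrightarrow> bounded {x. f x \<noteq> 0}"
  using Ck.simps(2)[of 0] Ck.simps(1)
  unfolding test_fun_def compact_closure differentiable_on_def by blast+

lemma Ck_all_pderiv: "(\<forall>k. f \<in> Ck k) \<Longrightarrow> (\<forall>k. pderiv_i i f \<in> Ck k)"
  by (metis (no_types, lifting) Ck.simps(2) mem_Collect_eq)

lemma Ck_all_affine:
  fixes f :: "real^'n::finite \<Rightarrow> real"
  assumes "\<forall>k. f \<in> Ck k"
  shows "(\<lambda>x. f (t *\<^sub>R x + h)) \<in> Ck k"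
    and "pderiv_i i (\<lambda>x. f (t *\<^sub>R x + h)) x = t * pderiv_i i f (t *\<^sub>R x + h)"
proof -
  have D: "((\<lambda>x. c * g (t *\<^sub>R x + h)) has_derivative
      (\<lambda>v. c * frechet_derivative g (at (t *\<^sub>R x + h)) (t *\<^sub>R v))) (at x)"
    if "\<forall>k. g \<in> Ck k" for c x and g :: "real^'n \<Rightarrow> real"
  proof -
    have "g \<in> Ck (Suc 0)" using that by blast
    then have "g differentiable (at (t *\<^sub>R x + h))"
      by (auto simp: differentiable_on_def)
    then have "(g has_derivative frechet_derivative g (at (t *\<^sub>R x + h))) (at (t *\<^sub>R x + h))"
      by (simp add: frechet_derivative_works)
    moreover have "((\<lambda>x. t *\<^sub>R x + h) has_derivative (\<lambda>v. t *\<^sub>R v)) (at x)"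
      by (auto intro!: derivative_eq_intros)
    ultimately have "((\<lambda>x. g (t *\<^sub>R x + h)) has_derivative
        (\<lambda>v. frechet_derivative g (at (t *\<^sub>R x + h)) (t *\<^sub>R v))) (at x)"
      using diff_chain_at by (fastforce simp: o_def)
    then show ?thesis by (rule has_derivative_mult_right)
  qed
  have P: "pderiv_i i (\<lambda>x. c * g (t *\<^sub>R x + h)) x = (c * t) * pderiv_i i g (t *\<^sub>R x + h)"
    if "\<forall>k. g \<in> Ck k" for c x i and g :: "real^'n \<Rightarrow> real"
  proof -
    have "g \<in> Ck (Suc 0)" using that by blast
    then have "linear (frechet_derivative g (at (t *\<^sub>R x + h)))"
      by (auto simp: differentiable_on_def intro: linear_frechet_derivative)
    then show ?thesis
      by (subst pderiv_i_eqI[OF D[OF that]]) (simp add: pderiv_i_def linear_scale)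
  qed
  show "pderiv_i i (\<lambda>x. f (t *\<^sub>R x + h)) x = t * pderiv_i i f (t *\<^sub>R x + h)"
    using P[OF assms, of i 1 x] by simp
  show "(\<lambda>x. f (t *\<^sub>R x + h)) \<in> Ck k"
  \<comment> \<open>Each derivative of g(t x + h) brings out a factor t. The free constant
    \<open>c\<close> absorbs it, so the class is closed under partial derivatives.\<close>
  proof (rule Ck_coinduct[of _ "{\<lambda>x. c * g (t *\<^sub>R x + h) | c g. \<forall>k. g \<in> Ck k}"])
    show "(\<lambda>x. f (t *\<^sub>R x + h)) \<in> {\<lambda>x. c * g (t *\<^sub>R x + h) | c g. \<forall>k. g \<in> Ck k}"
      using assms by (auto intro!: exI[of _ 1] exI[of _ f])
    fix u assume "u \<in> {\<lambda>x. c * g (t *\<^sub>R x + h) | c g. \<forall>k. g \<in> Ck k}"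
    then obtain c g where g: "u = (\<lambda>x. c * g (t *\<^sub>R x + h))" "\<forall>k. g \<in> Ck k" by auto
    show "u differentiable (at x)" for x
      using D[OF g(2)] g(1) by (auto simp: differentiable_def)
    have "pderiv_i i u = (\<lambda>x. (c * t) * pderiv_i i g (t *\<^sub>R x + h))" for i
      unfolding g(1) using P[OF g(2)] by auto
    then show "pderiv_i i u \<in> {\<lambda>x. c * g (t *\<^sub>R x + h) | c g. \<forall>k. g \<in> Ck k}" for i
      using Ck_all_pderiv[OF g(2), of i] by auto
  qed
qed

lemma test_fun_affine:
  assumes "test_fun f" "t \<noteq> 0"
  shows "test_fun (\<lambda>x. f (t *\<^sub>R x + h))"
proof -
  have "{x. f (t *\<^sub>R x + h) \<noteq> 0} \<subseteq> (\<lambda>y. (1/t) *\<^sub>R (y - h)) ` {x. f x \<noteq> 0}"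
    using assms(2) by (auto intro!: image_eqI[of _ _ "t *\<^sub>R x + h" for x])
  also have "\<dots> = (\<lambda>y. (1/t) *\<^sub>R y) ` (\<lambda>y. - h + y) ` {x. f x \<noteq> 0}"
    by (auto simp: image_image)
  finally have "bounded {x. f (t *\<^sub>R x + h) \<noteq> 0}"
    using bounded_scaling bounded_translation test_funD(3)[OF assms(1)] bounded_subset by meson
  then show ?thesis
    using assms(1) Ck_all_affine(1)[of f] by (simp add: test_fun_def compact_closure)
qed

text \<open>Off the closed support, \<open>f\<close> vanishes on an open set, so its partial
  derivatives vanish there too and the support stays bounded.\<close>

lemma test_fun_pderiv:
  fixes f :: "real^'n::finite \<Rightarrow> real"
  assumes "test_fun f"
  shows "test_fun (pderiv_i i f)"
proof -
  have "pderiv_i i f x = 0" if "x \<notin> closure {x. f x \<noteq> 0}" for x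
  proof -
    have "(f has_derivative (\<lambda>_. 0)) (at x)"
      by (rule has_derivative_transform_within_open[where f = "\<lambda>_. 0" and s = "- closure {x. f x \<noteq> 0}"])
        (use that closure_subset[of "{x. f x \<noteq> 0}"] in auto)
    then show ?thesis by (rule pderiv_i_eqI)
  qed
  then have "{x. pderiv_i i f x \<noteq> 0} \<subseteq> closure {x. f x \<noteq> 0}" by blast
  then have "bounded {x. pderiv_i i f x \<noteq> 0}"
    using test_funD(3)[OF assms] by (meson bounded_closure bounded_subset)
  then show ?thesis
    using assms Ck_all_pderiv[of f i] by (simp add: test_fun_def compact_closure)
qed

text \<open>This form supplies dominating functions: a multiple of the indicator of a ball is in
  \<open>L2\<close>, and so is integrable against any \<open>L2\<close> function.\<close>

lemma test_fun_bound:
  assumes "test_fun f"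
  obtains B R where "B \<ge> 0" "R > 0" "\<And>x. \<bar>f x\<bar> \<le> B * indicator (cball 0 R) x"
proof -
  obtain R where R: "R > 0" "\<And>x. f x \<noteq> 0 \<Longrightarrow> norm x \<le> R"
    using test_funD(3)[OF assms] by (auto simp: bounded_pos)
  have "compact (f ` cball 0 R)"
    using continuous_on_subset[OF test_funD(2)[OF assms]] by (intro compact_continuous_image) auto
  then obtain B where B: "\<And>x. norm x \<le> R \<Longrightarrow> \<bar>f x\<bar> \<le> B"
    by (fastforce dest!: compact_imp_bounded simp: bounded_iff)
  have "0 \<le> B" using B[of 0] R(1) by auto
  moreover have "\<bar>f x\<bar> \<le> B * indicator (cball 0 R) x" for x
    using B[of x] R(2)[of x] by (auto simp: indicator_def)
  ultimately show thesis using that R(1) by blast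
qed

section \<open>Uniqueness of weak gradients\<close>

lemma L2D: "L2 f \<Longrightarrow> f \<in> borel_measurable lebesgue" "L2 f \<Longrightarrow> integrable lebesgue (\<lambda>x. (f x)\<^sup>2)"
  by (auto simp: L2_def)

lemma abs_mult_le_sum_squares: "\<bar>a * b\<bar> \<le> a\<^sup>2 + (b\<^sup>2 :: real)"
proof -
  have "2 * (\<bar>a\<bar> * \<bar>b\<bar>) \<le> a\<^sup>2 + b\<^sup>2"
    using sum_squares_bound[of "\<bar>a\<bar>" "\<bar>b\<bar>"] by simp
  moreover have "0 \<le> \<bar>a\<bar> * \<bar>b\<bar>" by simp
  ultimately show ?thesis unfolding abs_mult by linarith
qed

lemma L2_mult_integrable:
  assumes "L2 f" "L2 g"
  shows "integrable lebesgue (\<lambda>x. f x * g x)"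
proof (rule Bochner_Integration.integrable_bound)
  show "integrable lebesgue (\<lambda>x. (f x)\<^sup>2 + (g x)\<^sup>2)"
    using assms by (auto dest: L2D)
  show "(\<lambda>x. f x * g x) \<in> borel_measurable lebesgue"
    using assms by (intro borel_measurable_times L2D)
qed (use abs_mult_le_sum_squares in auto)

lemma L2_diff:
  assumes "L2 f" "L2 g"
  shows "L2 (\<lambda>x. f x - g x)"
proof -
  have "integrable lebesgue (\<lambda>x. (f x)\<^sup>2 + (g x)\<^sup>2 - 2 * (f x * g x))"
    using assms L2_mult_integrable[OF assms] by (intro Bochner_Integration.integrable_diff Bochner_Integration.integrable_add integrable_mult_right L2D)
  then show ?thesis
    using assms by (auto dest: L2D simp: L2_def power2_eq_square algebra_simps)
qed

lemma L2_indicator: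
  fixes S :: "(real^'n::finite) set"
  assumes "S \<in> lmeasurable"
  shows "L2 (\<lambda>x. c * indicator S x)"
proof -
  have "integrable lebesgue (\<lambda>x. c\<^sup>2 * indicator S x :: real)"
    using assms by (auto simp: fmeasurable_def)
  moreover have "(\<lambda>x. (c * indicator S x)\<^sup>2) = (\<lambda>x. c\<^sup>2 * indicator S x :: real)"
    by (auto simp: indicator_def)
  ultimately show ?thesis
    using assms by (auto simp: L2_def fmeasurable_def)
qed

lemma test_fun_measurable:
  assumes "test_fun f"
  shows "f \<in> borel_measurable lebesgue"
  by (rule measurable_completion) (simp add: borel_measurable_continuous_onI[OF test_funD(2)[OF assms]])

lemma L2_test_fun:
  fixes f :: "real^'n::finite \<Rightarrow> real"
  assumes "test_fun f"
  shows "L2 f"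
proof -
  obtain B R where B: "B \<ge> 0" "\<And>x. \<bar>f x\<bar> \<le> B * indicator (cball 0 R) x"
    using test_fun_bound[OF assms] by metis
  have "integrable lebesgue (\<lambda>x. (f x)\<^sup>2)"
  proof (rule Bochner_Integration.integrable_bound)
    show "integrable lebesgue (\<lambda>x. (B * indicator (cball (0::real^'n) R) x)\<^sup>2)"
      by (rule L2D(2), rule L2_indicator) simp
    show "(\<lambda>x. (f x)\<^sup>2) \<in> borel_measurable lebesgue"
      using test_fun_measurable[OF assms] by measurable
    have "(f x)\<^sup>2 \<le> (B * indicator (cball 0 R) x)\<^sup>2" for x
      using power_mono[OF B(2)[of x], of 2] by simp
    then show "AE x in lebesgue. norm ((f x)\<^sup>2) \<le> norm ((B * indicator (cball 0 R) x)\<^sup>2)"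
      by simp
  qed
  then show ?thesis using test_fun_measurable[OF assms] by (simp add: L2_def)
qed

text \<open>A Lebesgue measurable set differs from a Borel set by a subset of a null set. Vanishing
  integrals therefore pass from Borel sets to all Lebesgue sets, and uniqueness of densities
  compares \<open>g\<close> with 0.\<close>

lemma AE_zero_if_borel_integrals_zero:
  fixes g :: "'a::euclidean_space \<Rightarrow> real"
  assumes int: "integrable lebesgue g"
    and zero: "\<And>A. A \<in> sets borel \<Longrightarrow> (\<integral>x. indicator A x * g x \<partial>lebesgue) = 0"
  shows "AE x in lebesgue. g x = 0"
proof (rule density_unique_real[OF int])
  fix A :: "'a set" assume A: "A \<in> sets lebesgue"
  then obtain S N N' where S: "A = S \<union> N" "N \<subseteq> N'" "N' \<in> null_sets lborel" "S \<in> sets lborel"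
    by (auto elim: sets_completionE)
  have "AE x in lebesgue. x \<notin> N'"
    by (intro AE_not_in null_sets_completionI S(3))
  then have "AE x in lebesgue. indicator A x *\<^sub>R g x = indicator S x * g x"
    using S(1,2) by (auto elim!: eventually_mono simp: indicator_def)
  then have "(\<integral>x. indicator A x *\<^sub>R g x \<partial>lebesgue) = (\<integral>x. indicator S x * g x \<partial>lebesgue)"
    using A S(4) int by (intro integral_cong_AE) (auto intro!: borel_measurable_times borel_measurable_indicator)
  also have "\<dots> = 0" using zero S(4) by simp
  finally show "set_lebesgue_integral lebesgue A g = set_lebesgue_integral lebesgue A (\<lambda>_. 0)"
    by (simp add: set_lebesgue_integral_def)
qed simp

text \<open>Boxes form an intersection-stable generator of the Borel sets, and the sets over which a
  fixed integrable function has integral 0 are closed under complements and disjoint unions once the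
  whole space is among them.\<close>

lemma AE_zero_if_box_integrals_zero:
  fixes g :: "'a::euclidean_space \<Rightarrow> real"
  assumes meas: "g \<in> borel_measurable lebesgue"
    and int: "\<And>a b. integrable lebesgue (\<lambda>x. indicator (box a b) x * g x)"
    and zero: "\<And>a b. (\<integral>x. indicator (box a b) x * g x \<partial>lebesgue) = 0"
  shows "AE x in lebesgue. g x = 0"
proof -
  \<comment> \<open>Since \<open>g\<close> is only assumed integrable on boxes, the Dynkin argument
    is run on its truncation to each of these boxes, which exhaust the space.\<close>
  define B :: "nat \<Rightarrow> 'a set" where "B n = box (- (real n *\<^sub>R One)) (real n *\<^sub>R One)" for n
  have "AE x in lebesgue. indicator (B n) x * g x = 0" for n
  proof (rule AE_zero_if_borel_integrals_zero)
    let ?f = "\<lambda>A x. indicator A x * (indicator (B n) x * g x)"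
    have intB: "integrable lebesgue (\<lambda>x. indicator (B n) x * g x)"
      unfolding B_def by (rule int)
    then have intA: "integrable lebesgue (?f A)" if "A \<in> sets borel" for A
      using integrable_mult_indicator[OF _ intB, of A] that by simp
    fix A :: "'a set" assume "A \<in> sets borel"
    then have A: "A \<in> sigma_sets UNIV (range (\<lambda>(a, b). box a b :: 'a set))"
      by (simp add: borel_eq_box)
    have stable: "Int_stable (range (\<lambda>(a, b). box a b :: 'a set))"
      by (auto simp: Int_stable_def Int_interval image_iff box_Int_box intro!: exI)
    have sub: "range (\<lambda>(a, b). box a b :: 'a set) \<subseteq> Pow UNIV" by simp
    from stable sub A show "(\<integral>x. ?f A x \<partial>lebesgue) = 0"
    proof (induction rule: sigma_sets_induct_disjoint)
      case (basic A)
      then obtain a b where "A = box a b" by auto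
      \<comment> \<open>The truncation does no harm on the generator: the intersection of two boxes
        is again a box, so \<open>zero\<close> applies.\<close>
      moreover obtain c d where "box a b \<inter> B n = box c d"
        unfolding B_def box_Int_box by blast
      ultimately have "?f A = (\<lambda>x. indicator (box c d) x * g x)"
        by (auto simp: fun_eq_iff indicator_def)
      then show ?case using zero by simp
    next
      case (compl A)
      then have "A \<in> sets borel" by (simp add: borel_eq_box)
      have "?f (UNIV - A) = (\<lambda>x. indicator (B n) x * g x - ?f A x)"
        by (auto simp: indicator_def fun_eq_iff)
      then show ?case
        using compl intA[OF \<open>A \<in> sets borel\<close>] intB zero by (simp add: B_def)
    next
      case (union A)
      then have A: "A i \<in> sets borel" for i by (auto simp: borel_eq_box)
      \<comment> \<open>Finite partial unions are handled by additivity. The passage to the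
        countable union is dominated by the absolute value of the truncated function.\<close>
      have "(\<lambda>m. \<integral>x. ?f (\<Union>i<m. A i) x \<partial>lebesgue) \<longlonglongrightarrow> (\<integral>x. ?f (\<Union>i. A i) x \<partial>lebesgue)"
      proof (rule integral_dominated_convergence)
        show "integrable lebesgue (\<lambda>x. \<bar>indicator (B n) x * g x\<bar>)"
          using intB by (rule integrable_abs)
        show "AE x in lebesgue. (\<lambda>m. ?f (\<Union>i<m. A i) x) \<longlonglongrightarrow> ?f (\<Union>i. A i) x"
        proof (rule AE_I2)
          fix x
          show "(\<lambda>m. ?f (\<Union>i<m. A i) x) \<longlonglongrightarrow> ?f (\<Union>i. A i) x"
            by (intro tendsto_intros LIMSEQ_indicator_UN)
        qed
        show "?f (\<Union>i. A i) \<in> borel_measurable lebesgue" "?f (\<Union>i<m. A i) \<in> borel_measurable lebesgue" for m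
          using A by (auto intro!: borel_measurable_integrable[OF intA])
      qed (simp add: indicator_def)
      moreover have "(\<integral>x. ?f (\<Union>i<m. A i) x \<partial>lebesgue) = 0" for m
      proof -
        have "indicator (\<Union>i<m. A i) x = (\<Sum>i<m. indicator (A i) x :: real)" for x
          using union(1) by (intro indicator_UN_disjoint) (auto simp: disjoint_family_on_def)
        then have "?f (\<Union>i<m. A i) x = (\<Sum>i<m. ?f (A i) x)" for x
          by (simp only: sum_distrib_right)
        then have "(\<integral>x. ?f (\<Union>i<m. A i) x \<partial>lebesgue) = (\<integral>x. (\<Sum>i<m. ?f (A i) x) \<partial>lebesgue)"
          by presburger
        also have "\<dots> = (\<Sum>i<m. \<integral>x. ?f (A i) x \<partial>lebesgue)"
          by (rule Bochner_Integration.integral_sum) (rule intA[OF A])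
        also have "\<dots> = 0" using union by simp
        finally show ?thesis .
      qed
      ultimately show ?case by (simp add: LIMSEQ_const_iff)
    qed auto
  qed (use int in \<open>simp add: B_def\<close>)
  then have "AE x in lebesgue. \<forall>n. indicator (B n) x * g x = 0"
    by (simp only: AE_all_countable) blast
  then show ?thesis
  proof eventually_elim
    case (elim x)
    obtain n where "x \<in> B n"
      using UN_box_eq_UNIV[where 'a = 'a] unfolding B_def by blast
    then have "indicator (B n) x = (1 :: real)" by simp
    with elim[rule_format, of n] show ?case by simp
  qed
qed

text \<open>The functions \<open>box_bump\<close> are test functions bounded by the indicator of the
  box and converging to it. Dominated convergence turns orthogonality into vanishing box
  integrals.\<close>

lemma L2_orthogonal_test_fun_imp_AE_zero:
  fixes g :: "real^'n::finite \<Rightarrow> real"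
  assumes g: "L2 g" and orth: "\<And>f. test_fun f \<Longrightarrow> (\<integral>x. g x * f x \<partial>lebesgue) = 0"
  shows "AE x in lebesgue. g x = 0"
proof (rule AE_zero_if_box_integrals_zero)
  show "g \<in> borel_measurable lebesgue" using g by (rule L2D)
  have ind: "L2 (\<lambda>x. indicator (box a b) x)" for a b :: "real^'n"
    using L2_indicator[of "box a b" 1] by simp
  show *: "integrable lebesgue (\<lambda>x. indicator (box a b) x * g x)" for a b
    by (rule L2_mult_integrable[OF ind g])
  show "(\<integral>x. indicator (box a b) x * g x \<partial>lebesgue) = 0" for a b
  proof -
    have "(\<lambda>n. \<integral>x. g x * box_bump a b (real (Suc n)) x \<partial>lebesgue) \<longlonglongrightarrow> (\<integral>x. indicator (box a b) x * g x \<partial>lebesgue)"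
    proof (rule integral_dominated_convergence)
      show "integrable lebesgue (\<lambda>x. \<bar>indicator (box a b) x * g x\<bar>)"
        using * by (rule integrable_abs)
      show "AE x in lebesgue. (\<lambda>n. g x * box_bump a b (real (Suc n)) x) \<longlonglongrightarrow> indicator (box a b) x * g x"
        by (subst mult.commute) (intro AE_I2 tendsto_intros tendsto_box_bump)
      show "AE x in lebesgue. norm (g x * box_bump a b (real (Suc n)) x) \<le> \<bar>indicator (box a b) x * g x\<bar>" for n
      proof (rule AE_I2)
        fix x
        show "norm (g x * box_bump a b (real (Suc n)) x) \<le> \<bar>indicator (box a b) x * g x\<bar>"
          using box_bump_eq_0_iff[of "real (Suc n)" a b x] box_bump_bounds[of a b "real (Suc n)" x]
          by (cases "x \<in> box a b") (auto simp: abs_mult intro!: mult_left_le)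
      qed
    qed (use * g test_fun_measurable[OF test_fun_box_bump, of "real (Suc n)" for n] L2D in \<open>auto intro!: borel_measurable_times\<close>)
    then show ?thesis
      using orth[OF test_fun_box_bump, of "real (Suc n)" for n] by (simp add: LIMSEQ_const_iff del: of_nat_Suc)
  qed
qed

text \<open>The components of the difference are square integrable and orthogonal to every test
  function. Hence the choice made in \<open>grad\<close> does not affect
  \<open>dirichlet\<close>.\<close>

lemma weak_grad_AE_unique:
  assumes "L2_grad u G" "L2_grad u G'"
  shows "AE x in lebesgue. G x = G' x"
proof -
  have "AE x in lebesgue. G x $ i - G' x $ i = 0" for i
  proof (rule L2_orthogonal_test_fun_imp_AE_zero)
    show "L2 (\<lambda>x. G x $ i - G' x $ i)"
      using assms by (intro L2_diff) (auto simp: L2_grad_def)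
    show "(\<integral>x. (G x $ i - G' x $ i) * f x \<partial>lebesgue) = 0" if "test_fun f" for f
    proof -
      have "integrable lebesgue (\<lambda>x. G x $ i * f x)" "integrable lebesgue (\<lambda>x. G' x $ i * f x)"
        using assms L2_test_fun[OF that] by (auto simp: L2_grad_def intro!: L2_mult_integrable)
      then show ?thesis
        using assms that by (auto simp: L2_grad_def weak_grad_def left_diff_distrib)
    qed
  qed
  then have "AE x in lebesgue. \<forall>i. G x $ i - G' x $ i = 0"
    by (simp add: AE_all_countable)
  then show ?thesis by (auto elim!: eventually_mono simp: vec_eq_iff)
qed

section \<open>Functions with a vanishing weak derivative\<close>

lemma
  fixes h :: "'a::euclidean_space"
  assumes "t > 0"
  shows lebesgue_scale_translate: "lebesgue = density (distr lebesgue lebesgue (\<lambda>x. t *\<^sub>R x + h)) (\<lambda>_. t ^ DIM('a))"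
    and measurable_scale_translate: "(\<lambda>x. t *\<^sub>R x + h) \<in> lebesgue \<rightarrow>\<^sub>M lebesgue"
proof -
  have eq: "(\<lambda>x. h + (\<Sum>j\<in>Basis. (t * (x \<bullet> j)) *\<^sub>R j)) = (\<lambda>x. t *\<^sub>R x + h)"
    unfolding scaleR_scaleR[symmetric] scaleR_sum_right[symmetric]
    by (simp add: euclidean_representation add.commute)
  show "lebesgue = density (distr lebesgue lebesgue (\<lambda>x. t *\<^sub>R x + h)) (\<lambda>_. t ^ DIM('a))"
    using lebesgue_affine_euclidean[of "\<lambda>_. t" h] assms by (simp add: eq)
  show "(\<lambda>x. t *\<^sub>R x + h) \<in> lebesgue \<rightarrow>\<^sub>M lebesgue"
    using lebesgue_affine_measurable[of "\<lambda>_. t" h] assms by (simp add: eq)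
qed

lemma
  fixes f :: "'a::euclidean_space \<Rightarrow> real" and h :: 'a
  assumes t: "t > 0" and f: "f \<in> borel_measurable lebesgue"
  shows integrable_scale_translate: "integrable lebesgue (\<lambda>x. f (t *\<^sub>R x + h)) \<longleftrightarrow> integrable lebesgue f"
    and integral_scale_translate: "(\<integral>x. f (t *\<^sub>R x + h) \<partial>lebesgue) = (\<integral>x. f x \<partial>lebesgue) / t ^ DIM('a)"
proof -
  note T = measurable_scale_translate[OF t, of h]
  have "integrable lebesgue f \<longleftrightarrow> integrable (density (distr lebesgue lebesgue (\<lambda>x. t *\<^sub>R x + h)) (\<lambda>_. t ^ DIM('a))) f"
    using lebesgue_scale_translate[OF t, of h] by simp
  also have "\<dots> \<longleftrightarrow> integrable (distr lebesgue lebesgue (\<lambda>x. t *\<^sub>R x + h)) (\<lambda>x. t ^ DIM('a) *\<^sub>R f x)"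
    using t f by (intro integrable_density) auto
  also have "\<dots> \<longleftrightarrow> integrable lebesgue (\<lambda>x. t ^ DIM('a) *\<^sub>R f (t *\<^sub>R x + h))"
    using f T by (intro integrable_distr_eq) auto
  also have "\<dots> \<longleftrightarrow> integrable lebesgue (\<lambda>x. f (t *\<^sub>R x + h))"
    using t by simp
  finally show "integrable lebesgue (\<lambda>x. f (t *\<^sub>R x + h)) \<longleftrightarrow> integrable lebesgue f" by simp
  have "(\<integral>x. f x \<partial>lebesgue) = (\<integral>x. f x \<partial>density (distr lebesgue lebesgue (\<lambda>x. t *\<^sub>R x + h)) (\<lambda>_. t ^ DIM('a)))"
    using lebesgue_scale_translate[OF t, of h] by simp
  also have "\<dots> = (\<integral>x. t ^ DIM('a) *\<^sub>R f x \<partial>distr lebesgue lebesgue (\<lambda>x. t *\<^sub>R x + h))"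
    using t f by (intro integral_density) auto
  also have "\<dots> = (\<integral>x. t ^ DIM('a) *\<^sub>R f (t *\<^sub>R x + h) \<partial>lebesgue)"
    using f T by (intro integral_distr) auto
  also have "\<dots> = t ^ DIM('a) * (\<integral>x. f (t *\<^sub>R x + h) \<partial>lebesgue)"
    using t by simp
  finally show "(\<integral>x. f (t *\<^sub>R x + h) \<partial>lebesgue) = (\<integral>x. f x \<partial>lebesgue) / t ^ DIM('a)"
    using t by (simp add: field_simps)
qed

lemma measurable_compose_scale_translate:
  assumes "t > 0" "f \<in> borel_measurable lebesgue"
  shows "(\<lambda>x. f (t *\<^sub>R x + h)) \<in> borel_measurable lebesgue"
  using measurable_compose[OF measurable_scale_translate[OF assms(1)] assms(2)] .

lemma L2_scale_translate:
  assumes "L2 f" "t > 0"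
  shows "L2 (\<lambda>x. c * f (t *\<^sub>R x + h))"
proof -
  have "(\<lambda>x. f (t *\<^sub>R x + h)) \<in> borel_measurable lebesgue"
    by (rule measurable_compose_scale_translate[OF assms(2) L2D(1)[OF assms(1)]])
  moreover have "integrable lebesgue (\<lambda>x. (f (t *\<^sub>R x + h))\<^sup>2)"
    using integrable_scale_translate[OF assms(2), of "\<lambda>x. (f x)\<^sup>2" h] assms(1) by (auto simp: L2_def)
  ultimately show ?thesis by (auto simp: L2_def power_mult_distrib)
qed

section \<open>Pairings with translated test functions\<close>

lemma test_fun_translate_derivative:
  fixes f :: "real^'n::finite \<Rightarrow> real"
  assumes "test_fun f"
  shows "((\<lambda>s. f (x + s *\<^sub>R axis i 1)) has_real_derivative pderiv_i i f (x + s *\<^sub>R axis i 1)) (at s)"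
proof -
  let ?F = "frechet_derivative f (at (x + s *\<^sub>R axis i 1))"
  have "(f has_derivative ?F) (at (x + s *\<^sub>R axis i 1))"
    using test_funD(1)[OF assms] by (simp add: frechet_derivative_works)
  moreover have "((\<lambda>s. x + s *\<^sub>R axis i 1) has_derivative (\<lambda>v. v *\<^sub>R axis i 1)) (at s)"
    by (auto intro!: derivative_eq_intros)
  ultimately have "((\<lambda>s. f (x + s *\<^sub>R axis i 1)) has_derivative (\<lambda>v. ?F (v *\<^sub>R axis i 1))) (at s)"
    by (rule diff_chain_at[rotated, unfolded o_def])
  moreover have "?F (v *\<^sub>R axis i 1) = pderiv_i i f (x + s *\<^sub>R axis i 1) * v" for v
    using linear_frechet_derivative[OF test_funD(1)[OF assms]] by (simp add: pderiv_i_def linear_scale)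
  ultimately show ?thesis
    by (simp add: has_field_derivative_def)
qed

text \<open>This is differentiation under the integral sign. The mean value theorem bounds the
  difference quotients of \<open>f\<close> by the maximum of its partial derivative on one fixed
  ball.\<close>

lemma translate_test_fun_has_derivative:
  fixes f u :: "real^'n::finite \<Rightarrow> real"
  assumes u: "L2 u" and f: "test_fun f"
  shows "((\<lambda>s. \<integral>x. u x * f (x + s *\<^sub>R axis i 1) \<partial>lebesgue) has_real_derivative
           (\<integral>x. u x * pderiv_i i f (x + s *\<^sub>R axis i 1) \<partial>lebesgue)) (at s)"
proof -
  let ?e = "axis i 1 :: real^'n"
  have tr: "test_fun (\<lambda>x. f (x + h))" for h
    using test_fun_affine[OF f, of 1 h] by simp
  have int: "integrable lebesgue (\<lambda>x. u x * f (x + h))" for h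
    by (rule L2_mult_integrable[OF u L2_test_fun[OF tr]])
  have meas: "(\<lambda>x. u x * f (x + h)) \<in> borel_measurable lebesgue" for h
    using int by (rule borel_measurable_integrable)
  obtain B R where B: "B \<ge> 0" "R > 0" "\<And>x. \<bar>pderiv_i i f x\<bar> \<le> B * indicator (cball 0 R) x"
    using test_fun_bound[OF test_fun_pderiv[OF f]] by metis
  define q where "q h x = u x * ((f (x + (s + h) *\<^sub>R ?e) - f (x + s *\<^sub>R ?e)) / h)" for h x
  have "(\<lambda>n. \<integral>x. q (X n) x \<partial>lebesgue) \<longlonglongrightarrow> (\<integral>x. u x * pderiv_i i f (x + s *\<^sub>R ?e) \<partial>lebesgue)"
    if X: "X \<longlonglongrightarrow> 0" "\<And>n. X n \<noteq> 0" for X :: "nat \<Rightarrow> real"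
  proof -
    obtain M where M: "\<And>n. \<bar>X n\<bar> \<le> M"
      using convergent_imp_Bseq[OF convergentI[OF X(1)]] by (auto simp: Bseq_def)
    \<comment> \<open>The quotient is a partial derivative of \<open>f\<close> at x + z e with z
      between s and s + X n. So |z| is at most |s| + M, and enlarging the radius by this amount
      covers all n.\<close>
    have *: "\<And>n. norm (q (X n) x) \<le> \<bar>u x * (B * indicator (cball 0 (R + \<bar>s\<bar> + M)) x)\<bar>" for x
    proof -
      fix n
      obtain z where z: "\<bar>z - s\<bar> \<le> \<bar>X n\<bar>"
        "f (x + (s + X n) *\<^sub>R ?e) - f (x + s *\<^sub>R ?e) = X n * pderiv_i i f (x + z *\<^sub>R ?e)"
      proof (cases "X n > 0")
        case True
        then have "\<exists>z. s < z \<and> z < s + X n \<and> f (x + (s + X n) *\<^sub>R ?e) - f (x + s *\<^sub>R ?e)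
            = (s + X n - s) * pderiv_i i f (x + z *\<^sub>R ?e)"
          by (intro MVT2 test_fun_translate_derivative[OF f]) auto
        then obtain z where "s < z" "z < s + X n" "f (x + (s + X n) *\<^sub>R ?e) - f (x + s *\<^sub>R ?e)
            = (s + X n - s) * pderiv_i i f (x + z *\<^sub>R ?e)" by blast
        then show ?thesis by (intro that[of z]) auto
      next
        case False
        then have "s + X n < s" using X(2)[of n] by simp
        then have "\<exists>z. s + X n < z \<and> z < s \<and> f (x + s *\<^sub>R ?e) - f (x + (s + X n) *\<^sub>R ?e)
            = (s - (s + X n)) * pderiv_i i f (x + z *\<^sub>R ?e)"
          by (intro MVT2 test_fun_translate_derivative[OF f]) auto
        then obtain z where "s + X n < z" "z < s" "f (x + s *\<^sub>R ?e) - f (x + (s + X n) *\<^sub>R ?e)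
            = (s - (s + X n)) * pderiv_i i f (x + z *\<^sub>R ?e)" by blast
        then show ?thesis by (intro that[of z]) (auto simp: algebra_simps)
      qed
      have "norm x \<le> norm (x + z *\<^sub>R ?e) + norm (z *\<^sub>R ?e)"
        using norm_triangle_ineq4[of "x + z *\<^sub>R ?e" "z *\<^sub>R ?e"] by simp
      then have "indicator (cball 0 R) (x + z *\<^sub>R ?e) \<le> (indicator (cball 0 (R + \<bar>s\<bar> + M)) x :: real)"
        using z(1) M[of n] by (auto simp: indicator_def)
      then have "\<bar>pderiv_i i f (x + z *\<^sub>R ?e)\<bar> \<le> B * indicator (cball 0 (R + \<bar>s\<bar> + M)) x"
        using B(3)[of "x + z *\<^sub>R ?e"] mult_left_mono[OF _ B(1)] by (meson order_trans)
      moreover have "q (X n) x = u x * pderiv_i i f (x + z *\<^sub>R ?e)"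
        using z(2) X(2)[of n] by (simp add: q_def)
      ultimately show "norm (q (X n) x) \<le> \<bar>u x * (B * indicator (cball 0 (R + \<bar>s\<bar> + M)) x)\<bar>"
        by (simp add: abs_mult mult_left_mono B(1))
    qed
    show ?thesis
    proof (rule integral_dominated_convergence)
      show "integrable lebesgue (\<lambda>x. \<bar>u x * (B * indicator (cball 0 (R + \<bar>s\<bar> + M)) x)\<bar>)"
        by (intro integrable_abs L2_mult_integrable u L2_indicator) simp
      show "(\<lambda>x. q (X n) x) \<in> borel_measurable lebesgue" for n
      proof -
        have "q (X n) = (\<lambda>x. (u x * f (x + (s + X n) *\<^sub>R ?e) - u x * f (x + s *\<^sub>R ?e)) / X n)"
          by (auto simp: q_def fun_eq_iff field_simps)
        then show ?thesis by (auto intro!: meas borel_measurable_diff borel_measurable_divide)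
      qed
      show "(\<lambda>x. u x * pderiv_i i f (x + s *\<^sub>R ?e)) \<in> borel_measurable lebesgue"
        using L2_mult_integrable[OF u L2_test_fun[OF test_fun_affine[OF test_fun_pderiv[OF f], of 1]]] by auto
      have "(\<lambda>n. q (X n) x) \<longlonglongrightarrow> u x * pderiv_i i f (x + s *\<^sub>R ?e)" for x
      proof -
        have "filterlim X (at 0) sequentially"
          using X by (simp add: filterlim_at)
        from filterlim_compose[OF test_fun_translate_derivative[OF f, of x i s, unfolded DERIV_def] this]
        show ?thesis unfolding q_def by (intro tendsto_mult tendsto_const)
      qed
      then show "AE x in lebesgue. (\<lambda>n. q (X n) x) \<longlonglongrightarrow> u x * pderiv_i i f (x + s *\<^sub>R ?e)" by simp
    qed (use * in auto)
  qed
  \<comment> \<open>Dominated convergence speaks of sequences; convergence along every nonzero null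
    sequence gives the limit at 0.\<close>
  then have "((\<lambda>h. \<integral>x. q h x \<partial>lebesgue) \<longlongrightarrow> (\<integral>x. u x * pderiv_i i f (x + s *\<^sub>R ?e) \<partial>lebesgue)) (at 0)"
    unfolding tendsto_at_iff_sequentially by (simp add: o_def)
  moreover have "(\<integral>x. q h x \<partial>lebesgue) =
      ((\<integral>x. u x * f (x + (s + h) *\<^sub>R ?e) \<partial>lebesgue) - (\<integral>x. u x * f (x + s *\<^sub>R ?e) \<partial>lebesgue)) / h" for h
  proof -
    have "q h = (\<lambda>x. (u x * f (x + (s + h) *\<^sub>R ?e) - u x * f (x + s *\<^sub>R ?e)) / h)"
      by (auto simp: q_def fun_eq_iff right_diff_distrib)
    then show ?thesis using int by simp
  qed
  ultimately show ?thesis by (simp add: DERIV_def)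
qed

text \<open>The translates of \<open>f\<close> keep their \<open>L2\<close> norm while their
  supports escape to infinity, where \<open>u\<close> has little \<open>L2\<close> mass.\<close>

lemma translate_test_fun_tendsto_0:
  fixes f u :: "real^'n::finite \<Rightarrow> real"
  assumes u: "L2 u" and f: "test_fun f" and e: "e \<noteq> 0"
  shows "(\<lambda>n. \<integral>x. u x * f (x + real n *\<^sub>R e) \<partial>lebesgue) \<longlonglongrightarrow> 0"
proof -
  obtain B R where B: "B \<ge> 0" "R > 0" "\<And>x. \<bar>f x\<bar> \<le> B * indicator (cball 0 R) x"
    using test_fun_bound[OF f] by metis
  define K where "K n = (\<lambda>x. indicator (cball 0 R) (x + real n *\<^sub>R e) :: real)" for n
  \<comment> \<open>Written as a translate, \<open>K n\<close> is easy to compare with the support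
    of the translated \<open>f\<close>; as the indicator of a ball about -n e it is visibly
    measurable.\<close>
  have K: "K n = indicator (cball (- (real n *\<^sub>R e)) R)" for n
  proof -
    have "x \<in> cball (- (real n *\<^sub>R e)) R \<longleftrightarrow> x + real n *\<^sub>R e \<in> cball 0 R" for x
    proof -
      have "dist (- (real n *\<^sub>R e)) x = norm (x + real n *\<^sub>R e)"
        by (subst dist_commute) (simp add: dist_norm)
      then show ?thesis by (simp only: mem_cball dist_0_norm)
    qed
    then show ?thesis by (intro ext) (simp only: K_def indicator_def)
  qed
  have tail: "(\<lambda>n. \<integral>x. K n x * (u x)\<^sup>2 \<partial>lebesgue) \<longlonglongrightarrow> integral\<^sup>L lebesgue (\<lambda>x::real^'n. 0)"
  proof (rule integral_dominated_convergence)
    show "integrable lebesgue (\<lambda>x. (u x)\<^sup>2)" using u by (rule L2D)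
    show "(\<lambda>x. K n x * (u x)\<^sup>2) \<in> borel_measurable lebesgue" for n
      unfolding K using L2D(1)[OF u] by (intro borel_measurable_times borel_measurable_power borel_measurable_indicator) auto
    have "eventually (\<lambda>n. K n x * (u x)\<^sup>2 = 0) sequentially" for x
    proof -
      have "filterlim (\<lambda>n. real n * norm e) at_top sequentially"
        by (rule filterlim_at_top_mult_tendsto_pos[OF tendsto_const _ filterlim_real_sequentially]) (use e in simp)
      then have "eventually (\<lambda>n. real n * norm e > R + norm x) sequentially"
        by (simp add: filterlim_at_top_dense)
      then show ?thesis
      proof eventually_elim
        case (elim n)
        have "real n * norm e \<le> norm (x + real n *\<^sub>R e) + norm x"
          using norm_triangle_ineq4[of "x + real n *\<^sub>R e" x] by simp
        with elim show ?case by (simp add: K_def)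
      qed
    qed
    then show "AE x in lebesgue. (\<lambda>n. K n x * (u x)\<^sup>2) \<longlonglongrightarrow> 0"
      by (intro AE_I2 tendsto_eventually)
  qed (auto simp: K_def indicator_def)
  have f2: "integrable lebesgue (\<lambda>x. (f x)\<^sup>2)" using L2_test_fun[OF f] by (rule L2D)
  define C where "C = (\<integral>x. (f x)\<^sup>2 \<partial>lebesgue)"
  have "C \<ge> 0" by (simp add: C_def)
  \<comment> \<open>Young's inequality with weight \<open>d\<close>, using that the translate of \<open>f\<close> lives where \<open>K n = 1\<close>.\<close>
  have bound: "\<bar>\<integral>x. u x * f (x + real n *\<^sub>R e) \<partial>lebesgue\<bar> \<le> d * C + (\<integral>x. K n x * (u x)\<^sup>2 \<partial>lebesgue) / d"
    if "d > 0" for d n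
  proof -
    have i1: "integrable lebesgue (\<lambda>x. (f (x + real n *\<^sub>R e))\<^sup>2)"
      and e1: "(\<integral>x. (f (x + real n *\<^sub>R e))\<^sup>2 \<partial>lebesgue) = C"
      using integrable_scale_translate[of 1 "\<lambda>x. (f x)\<^sup>2" "real n *\<^sub>R e"] 
        integral_scale_translate[of 1 "\<lambda>x. (f x)\<^sup>2" "real n *\<^sub>R e"] f2 by (auto simp: C_def)
    have i2: "integrable lebesgue (\<lambda>x. K n x * (u x)\<^sup>2)"
      unfolding K using integrable_mult_indicator[OF _ L2D(2)[OF u], of "cball (- (real n *\<^sub>R e)) R"] by simp
    have "\<bar>\<integral>x. u x * f (x + real n *\<^sub>R e) \<partial>lebesgue\<bar> \<le> (\<integral>x. \<bar>u x * f (x + real n *\<^sub>R e)\<bar> \<partial>lebesgue)"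
      by (rule integral_abs_bound)
    also have "\<dots> \<le> (\<integral>x. d * (f (x + real n *\<^sub>R e))\<^sup>2 + K n x * (u x)\<^sup>2 / d \<partial>lebesgue)"
    proof (rule integral_mono')
      show "integrable lebesgue (\<lambda>x. d * (f (x + real n *\<^sub>R e))\<^sup>2 + K n x * (u x)\<^sup>2 / d)"
        using i1 i2 by simp
      show "0 \<le> d * (f (x + real n *\<^sub>R e))\<^sup>2 + K n x * (u x)\<^sup>2 / d" for x
        using that by (simp add: K_def)
      show "\<bar>u x * f (x + real n *\<^sub>R e)\<bar> \<le> d * (f (x + real n *\<^sub>R e))\<^sup>2 + K n x * (u x)\<^sup>2 / d" for x
      proof (cases "K n x = 0")
        case True
        then have "f (x + real n *\<^sub>R e) = 0" using B(3)[of "x + real n *\<^sub>R e"] by (simp add: K_def)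
        with True show ?thesis by simp
      next
        case False
        then have "K n x = 1" by (simp add: K_def indicator_def split: if_splits)
        have "\<bar>(u x / sqrt d) * (sqrt d * f (x + real n *\<^sub>R e))\<bar> \<le> (u x / sqrt d)\<^sup>2 + (sqrt d * f (x + real n *\<^sub>R e))\<^sup>2"
          by (rule abs_mult_le_sum_squares)
        with that \<open>K n x = 1\<close> show ?thesis
          by (simp add: power_mult_distrib power_divide)
      qed
    qed
    also have "\<dots> = d * C + (\<integral>x. K n x * (u x)\<^sup>2 \<partial>lebesgue) / d"
      using i1 i2 e1 by simp
    finally show ?thesis .
  qed
  show ?thesis
  proof (rule LIMSEQ_I)
    fix r :: real assume r: "r > 0"
    \<comment> \<open>This weight bounds the first term of \<open>bound\<close> by r/2. The summand
      1 keeps the denominator positive when C = 0.\<close>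
    define d where "d = r / (2 * (C + 1))"
    have d: "d > 0" "d * C \<le> r / 2"
      using r \<open>C \<ge> 0\<close> by (auto simp: d_def field_simps)
    have "eventually (\<lambda>n. (\<integral>x. K n x * (u x)\<^sup>2 \<partial>lebesgue) < d * (r / 2)) sequentially"
      using order_tendstoD(2)[OF tail, of "d * (r / 2)"] d r by simp
    then obtain M where M: "\<And>n. n \<ge> M \<Longrightarrow> (\<integral>x. K n x * (u x)\<^sup>2 \<partial>lebesgue) < d * (r / 2)"
      by (auto simp: eventually_sequentially)
    have "norm ((\<integral>x. u x * f (x + real n *\<^sub>R e) \<partial>lebesgue) - 0) < r" if "n \<ge> M" for n
    proof -
      have "(\<integral>x. K n x * (u x)\<^sup>2 \<partial>lebesgue) / d < r / 2"
        using M[OF that] d(1) by (simp add: field_simps)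
      with bound[OF d(1), of n] d(2) have "\<bar>\<integral>x. u x * f (x + real n *\<^sub>R e) \<partial>lebesgue\<bar> < r"
        by linarith
      then show ?thesis by simp
    qed
    then show "\<exists>M. \<forall>n\<ge>M. norm ((\<integral>x. u x * f (x + real n *\<^sub>R e) \<partial>lebesgue) - 0) < r" by blast
  qed
qed

text \<open>A vanishing weak derivative makes \<open>\<integral> u(x) f(x + s e) dx\<close> constant in \<open>s\<close>, while square integrability of \<open>u\<close>
  makes it vanish as \<open>s \<rightarrow> \<infinity>\<close>.\<close>

lemma zero_weak_partial_imp_AE_zero:
  fixes u :: "real^'n::finite \<Rightarrow> real"
  assumes u: "L2 u" and zero: "\<And>f. test_fun f \<Longrightarrow> (\<integral>x. u x * pderiv_i i f x \<partial>lebesgue) = 0"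
  shows "AE x in lebesgue. u x = 0"
proof (rule L2_orthogonal_test_fun_imp_AE_zero[OF u])
  fix f :: "real^'n \<Rightarrow> real" assume f: "test_fun f"
  define F where "F s = (\<integral>x. u x * f (x + s *\<^sub>R axis i 1) \<partial>lebesgue)" for s
  have "(F has_real_derivative 0) (at s)" for s
  proof -
    \<comment> \<open>The hypothesis is applied to the translated test function, whose partial
      derivative is the translate of that of \<open>f\<close>.\<close>
    have "test_fun (\<lambda>x. f (1 *\<^sub>R x + s *\<^sub>R axis i 1))"
      by (rule test_fun_affine[OF f]) simp
    from zero[OF this] have "(\<integral>x. u x * pderiv_i i f (x + s *\<^sub>R axis i 1) \<partial>lebesgue) = 0"
      using f by (subst (asm) Ck_all_affine(2)) (simp_all add: test_fun_def)
    then show ?thesis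
      using translate_test_fun_has_derivative[OF u f, of i s] by (simp add: F_def [abs_def])
  qed
  then have "F s = F 0" for s by (intro DERIV_isconst_all allI)
  then have "(\<lambda>n. F (real n)) = (\<lambda>n. F 0)" by (intro ext)
  moreover have "(\<lambda>n. F (real n)) \<longlonglongrightarrow> 0"
    using translate_test_fun_tendsto_0[OF u f, of "axis i 1"] by (simp add: F_def)
  ultimately have "F 0 = 0" by (simp only: LIMSEQ_const_iff)
  then show "(\<integral>x. u x * f x \<partial>lebesgue) = 0" by (simp add: F_def)
qed

section \<open>Scaling\<close>

lemma norm_squared_vec: "(norm (x :: real^'n::finite))\<^sup>2 = (\<Sum>i\<in>UNIV. (x $ i)\<^sup>2)"
  by (simp add: norm_vec_def L2_set_def sum_nonneg)

lemma L2_grad_norm_integrable: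
  "L2_grad u G \<Longrightarrow> integrable lebesgue (\<lambda>x. (norm (G x))\<^sup>2)"
  unfolding norm_squared_vec by (auto simp: L2_grad_def L2_def)

lemma H1_L2: "u \<in> H1 \<Longrightarrow> L2 u"
  by (simp add: H1_def)

lemma H1_L2_grad: "u \<in> H1 \<Longrightarrow> L2_grad u (grad u)"
  unfolding H1_def grad_def by (auto intro: someI_ex[of "L2_grad u"])

text \<open>This frees the energy from the choice in \<open>grad\<close>: after scaling it can be
  computed from the explicit weak gradient.\<close>

lemma dirichlet_eq:
  assumes "L2 u" "L2_grad u G"
  shows "dirichlet u = (\<integral>x. (norm (G x))\<^sup>2 \<partial>lebesgue)"
proof -
  have H: "L2_grad u (grad u)"
    using assms by (intro H1_L2_grad) (auto simp: H1_def)
  have "AE x in lebesgue. grad u x = G x"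
    using H assms(2) by (rule weak_grad_AE_unique)
  then show ?thesis
    unfolding dirichlet_def
    using L2_grad_norm_integrable[OF H] L2_grad_norm_integrable[OF assms(2)]
    by (intro integral_cong_AE) (auto elim!: eventually_mono)
qed

lemma dirichlet_nonneg: "dirichlet u \<ge> 0"
  by (simp add: dirichlet_def)

lemma coupling_nonneg: "coupling \<alpha> \<beta> u v \<ge> 0"
  by (simp add: coupling_def)

text \<open>Zero energy makes \<open>u\<close> orthogonal to all partial derivatives of test
  functions, hence zero almost everywhere. Positivity permits dividing by the energy in the scaling
  quotient.\<close>

lemma dirichlet_pos:
  fixes u :: "real^'n::finite \<Rightarrow> real"
  assumes u: "u \<in> H1" and pos: "L2norm u > 0"
  shows "dirichlet u > 0"
proof (rule ccontr)
  assume "\<not> dirichlet u > 0"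
  then have "(\<integral>x. (norm (grad u x))\<^sup>2 \<partial>lebesgue) = 0"
    using dirichlet_nonneg[of u] unfolding dirichlet_def by linarith
  then have "AE x in lebesgue. (norm (grad u x))\<^sup>2 = 0"
    using integral_nonneg_eq_0_iff_AE[OF L2_grad_norm_integrable[OF H1_L2_grad[OF u]]] by simp
  then have G: "AE x in lebesgue. grad u x = 0" by simp
  have "AE x in lebesgue. u x = 0"
  proof (rule zero_weak_partial_imp_AE_zero[OF H1_L2[OF u]])
    fix f :: "real^'n \<Rightarrow> real" and i :: 'n assume f: "test_fun f"
    have "(\<integral>x. u x * pderiv_i i f x \<partial>lebesgue) = - (\<integral>x. grad u x $ i * f x \<partial>lebesgue)"
      using H1_L2_grad[OF u] f by (auto simp: L2_grad_def weak_grad_def)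
    also have "(\<integral>x. grad u x $ i * f x \<partial>lebesgue) = 0"
      using G by (intro integral_eq_zero_AE) (auto elim!: eventually_mono)
    finally show "(\<integral>x. u x * pderiv_i i f x \<partial>lebesgue) = 0" by simp
  qed
  then have "(\<integral>x. (u x)\<^sup>2 \<partial>lebesgue) = 0"
    by (intro integral_eq_zero_AE) (auto elim!: eventually_mono)
  with pos show False by (simp add: L2norm_def)
qed

lemma L2_grad_scale:
  fixes u :: "real^'n::finite \<Rightarrow> real"
  assumes u: "L2 u" and G: "L2_grad u G" and t: "t > 0"
  shows "L2_grad (\<lambda>x. c * u (t *\<^sub>R x)) (\<lambda>x. (c * t) *\<^sub>R G (t *\<^sub>R x))"
  unfolding L2_grad_def weak_grad_def
proof (intro conjI allI impI)
  have Gi: "L2 (\<lambda>x. G x $ i)" for i using G by (auto simp: L2_grad_def)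
  show "L2 (\<lambda>x. ((c * t) *\<^sub>R G (t *\<^sub>R x)) $ i)" for i
    using L2_scale_translate[OF Gi t, of "c * t" 0] by simp
  fix f :: "real^'n \<Rightarrow> real" and i :: 'n assume f: "test_fun f"
  \<comment> \<open>Pulling the test function back by y = t x moves the scaling onto it. The factor
    1/t from its derivative is matched by the extra t in the scaled gradient.\<close>
  define g where "g y = f ((1 / t) *\<^sub>R y + 0)" for y
  have g: "test_fun g"
    unfolding g_def using t by (intro test_fun_affine[OF f]) simp
  have dg: "pderiv_i i g y = (1 / t) * pderiv_i i f ((1 / t) *\<^sub>R y)" for y
    unfolding g_def using f by (subst Ck_all_affine(2)) (auto simp: test_fun_def)
  have "(\<integral>x. c * u (t *\<^sub>R x) * pderiv_i i f x \<partial>lebesgue)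
      = (\<integral>x. (\<lambda>y. (c * t) * (u y * pderiv_i i g y)) (t *\<^sub>R x + 0) \<partial>lebesgue)"
    using t by (simp add: dg mult.assoc)
  also have "\<dots> = (\<integral>y. (c * t) * (u y * pderiv_i i g y) \<partial>lebesgue) / t ^ DIM(real^'n)"
    using L2D(1)[OF u] test_fun_measurable[OF test_fun_pderiv[OF g]]
    by (intro integral_scale_translate t borel_measurable_times) auto
  also have "\<dots> = - ((\<integral>y. (c * t) * (G y $ i * g y) \<partial>lebesgue) / t ^ DIM(real^'n))"
    using G g by (simp add: L2_grad_def weak_grad_def)
  also have "(\<integral>y. (c * t) * (G y $ i * g y) \<partial>lebesgue) / t ^ DIM(real^'n)
      = (\<integral>x. (\<lambda>y. (c * t) * (G y $ i * g y)) (t *\<^sub>R x + 0) \<partial>lebesgue)"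
    using L2D(1)[OF Gi] test_fun_measurable[OF g]
    by (intro integral_scale_translate[symmetric] t borel_measurable_times) auto
  also have "\<dots> = (\<integral>x. ((c * t) *\<^sub>R G (t *\<^sub>R x)) $ i * f x \<partial>lebesgue)"
    using t by (simp add: g_def mult.assoc)
  finally show "(\<integral>x. c * u (t *\<^sub>R x) * pderiv_i i f x \<partial>lebesgue)
      = - (\<integral>x. ((c * t) *\<^sub>R G (t *\<^sub>R x)) $ i * f x \<partial>lebesgue)" .
qed

text \<open>The exponent \<open>N/2\<close> makes the dilation preserve the \<open>L\<^sup>2\<close> norm.\<close>

definition dilate :: "real \<Rightarrow> real \<Rightarrow> (real^'n::finite \<Rightarrow> real) \<Rightarrow> real^'n \<Rightarrow> real" where
  "dilate c t u x = c * t powr (real CARD('n) / 2) * u (t *\<^sub>R x)"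

section \<open>Norms and integrals under dilation\<close>

lemma powr_card: "t > 0 \<Longrightarrow> t powr real CARD('n::finite) = t ^ DIM(real^'n)"
  by (simp add: powr_realpow)

lemma dilate_H1:
  fixes u :: "real^'n::finite \<Rightarrow> real"
  assumes u: "u \<in> H1" and t: "t > 0"
  shows "dilate c t u \<in> H1"
    and "dirichlet (dilate c t u) = c\<^sup>2 * t\<^sup>2 * dirichlet u"
proof -
  let ?c = "c * t powr (real CARD('n) / 2)"
  note G = H1_L2_grad[OF u]
  have eq: "dilate c t u = (\<lambda>x. ?c * u (t *\<^sub>R x))" by (simp add: dilate_def fun_eq_iff)
  have L: "L2 (dilate c t u)"
    using L2_scale_translate[OF H1_L2[OF u] t, of ?c 0] by (simp add: eq)
  have LG: "L2_grad (dilate c t u) (\<lambda>x. (?c * t) *\<^sub>R grad u (t *\<^sub>R x))"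
    unfolding eq by (rule L2_grad_scale[OF H1_L2[OF u] G t])
  show "dilate c t u \<in> H1" using L LG by (auto simp: H1_def)
  have "dirichlet (dilate c t u) = (\<integral>x. (\<lambda>y. (?c * t)\<^sup>2 * (norm (grad u y))\<^sup>2) (t *\<^sub>R x + 0) \<partial>lebesgue)"
    by (simp add: dirichlet_eq[OF L LG] power_mult_distrib)
  also have "\<dots> = (\<integral>y. (?c * t)\<^sup>2 * (norm (grad u y))\<^sup>2 \<partial>lebesgue) / t ^ DIM(real^'n)"
    using L2_grad_norm_integrable[OF G] by (intro integral_scale_translate t) auto
  also have "\<dots> = ?c\<^sup>2 * t\<^sup>2 * dirichlet u / t powr real CARD('n)"
    by (simp only: powr_card[OF t, where 'n = 'n]) (simp add: dirichlet_def power_mult_distrib)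
  also have "?c\<^sup>2 = c\<^sup>2 * t powr real CARD('n)"
    by (simp add: power_mult_distrib power2_eq_square flip: powr_add)
  finally show "dirichlet (dilate c t u) = c\<^sup>2 * t\<^sup>2 * dirichlet u"
    using t by simp
qed

lemma powr_abs_dilate:
  fixes u :: "real^'n::finite \<Rightarrow> real"
  assumes "c > 0" "t > 0"
  shows "\<bar>dilate c t u x\<bar> powr q = c powr q * t powr (real CARD('n) * q / 2) * \<bar>u (t *\<^sub>R x)\<bar> powr q"
  using assms by (simp add: dilate_def abs_mult powr_mult powr_powr)

text \<open>The amplitude contributes N q / 2 to the exponent of t and the Jacobian contributes -N.
  For N > 2 and the critical q the total is q, so the integral scales like (c t)^q against (c t)^2
  for the Dirichlet energy.\<close>

lemma Lp_pow_dilate: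
  fixes u :: "real^'n::finite \<Rightarrow> real"
  assumes u: "u \<in> borel_measurable lebesgue" and c: "c > 0" and t: "t > 0"
  shows "Lp_pow q (dilate c t u) = c powr q * t powr (real CARD('n) * q / 2 - real CARD('n)) * Lp_pow q u"
proof -
  let ?k = "c powr q * t powr (real CARD('n) * q / 2)"
  have "Lp_pow q (dilate c t u) = (\<integral>x. (\<lambda>y. ?k * \<bar>u y\<bar> powr q) (t *\<^sub>R x + 0) \<partial>lebesgue)"
    by (simp add: Lp_pow_def powr_abs_dilate[OF c t])
  also have "\<dots> = (\<integral>y. ?k * \<bar>u y\<bar> powr q \<partial>lebesgue) / t ^ DIM(real^'n)"
    using u by (intro integral_scale_translate t) auto
  also have "\<dots> = ?k * Lp_pow q u / t powr real CARD('n)"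
    by (simp only: powr_card[OF t, where 'n = 'n]) (simp add: Lp_pow_def)
  finally show ?thesis by (simp add: powr_diff)
qed

lemma Lp_pow_integrable_dilate:
  fixes u :: "real^'n::finite \<Rightarrow> real"
  assumes u: "u \<in> borel_measurable lebesgue" and c: "c > 0" and t: "t > 0"
    and int: "integrable lebesgue (\<lambda>x. \<bar>u x\<bar> powr q)"
  shows "integrable lebesgue (\<lambda>x. \<bar>dilate c t u x\<bar> powr q)"
proof -
  have "integrable lebesgue (\<lambda>x. (\<lambda>y. \<bar>u y\<bar> powr q) (t *\<^sub>R x + 0))"
    using u int by (subst integrable_scale_translate[OF t]) auto
  then show ?thesis by (simp add: powr_abs_dilate[OF c t])
qed

text \<open>This exponent explains the coefficient in \<open>P_nu\<close>: for N > 2 that functional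
  is the derivative at t = 1 of the energy along the common dilation with c = 1.\<close>

lemma coupling_dilate:
  fixes u v :: "real^'n::finite \<Rightarrow> real"
  assumes u: "u \<in> borel_measurable lebesgue" and v: "v \<in> borel_measurable lebesgue" and t: "t > 0"
  shows "coupling \<alpha> \<beta> (dilate 1 t u) (dilate 1 t v) = t powr gamma_ab TYPE('n) \<alpha> \<beta> * coupling \<alpha> \<beta> u v"
proof -
  let ?k = "t powr (real CARD('n) * (\<alpha> + \<beta>) / 2)"
  have "t powr (real CARD('n) * \<alpha> / 2) * t powr (real CARD('n) * \<beta> / 2) = ?k"
    by (simp add: algebra_simps add_divide_distrib flip: powr_add)
  then have "\<bar>dilate 1 t u x\<bar> powr \<alpha> * \<bar>dilate 1 t v x\<bar> powr \<beta>
      = ?k * (\<bar>u (t *\<^sub>R x)\<bar> powr \<alpha> * \<bar>v (t *\<^sub>R x)\<bar> powr \<beta>)" for x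
    using t by (simp add: powr_abs_dilate algebra_simps)
  then have "coupling \<alpha> \<beta> (dilate 1 t u) (dilate 1 t v)
      = (\<integral>x. (\<lambda>y. ?k * (\<bar>u y\<bar> powr \<alpha> * \<bar>v y\<bar> powr \<beta>)) (t *\<^sub>R x + 0) \<partial>lebesgue)"
    by (simp add: coupling_def)
  also have "\<dots> = (\<integral>y. ?k * (\<bar>u y\<bar> powr \<alpha> * \<bar>v y\<bar> powr \<beta>) \<partial>lebesgue) / t ^ DIM(real^'n)"
    using u v by (intro integral_scale_translate t) auto
  also have "\<dots> = (?k / t powr real CARD('n)) * coupling \<alpha> \<beta> u v"
    by (simp only: powr_card[OF t, where 'n = 'n]) (simp add: coupling_def)
  also have "?k / t powr real CARD('n) = t powr gamma_ab TYPE('n) \<alpha> \<beta>"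
    by (simp add: gamma_ab_def algebra_simps diff_divide_distrib flip: powr_diff)
  finally show ?thesis .
qed

lemma L2norm_dilate:
  fixes u :: "real^'n::finite \<Rightarrow> real"
  assumes u: "u \<in> borel_measurable lebesgue" and c: "c > 0" and t: "t > 0"
  shows "L2norm (dilate c t u) = c * L2norm u"
proof -
  have eq: "L2norm w = sqrt (Lp_pow 2 w)" for w :: "real^'n \<Rightarrow> real"
    by (simp add: L2norm_def Lp_pow_def)
  show ?thesis
    using c t by (simp add: eq Lp_pow_dilate[OF u c t] real_sqrt_mult)
qed

section \<open>Bounds for the coupling\<close>

lemma powr_mult_powr_le:
  fixes x y :: real
  assumes "x \<ge> 0" "y \<ge> 0" "\<alpha> > 0" "\<beta> > 0"
  shows "x powr \<alpha> * y powr \<beta> \<le> x powr (\<alpha> + \<beta>) + y powr (\<alpha> + \<beta>)"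
proof (cases "x \<le> y")
  case True
  then have "x powr \<alpha> * y powr \<beta> \<le> y powr \<alpha> * y powr \<beta>"
    using assms by (intro mult_right_mono powr_mono2) auto
  then show ?thesis by (simp add: powr_add add_increasing)
next
  case False
  then have "x powr \<alpha> * y powr \<beta> \<le> x powr \<alpha> * x powr \<beta>"
    using assms by (intro mult_left_mono powr_mono2) auto
  then show ?thesis by (simp add: powr_add add_increasing2)
qed

text \<open>Multiplying |u| by d and |v| by d^(-\<alpha>/\<beta>) leaves the integrand unchanged, so
  the pointwise bound acquires a free weight d.\<close>

lemma coupling_le:
  fixes u v :: "real^'n::finite \<Rightarrow> real"
  assumes ab: "\<alpha> > 0" "\<beta> > 0" and d: "d > 0"
    and u: "integrable lebesgue (\<lambda>x. \<bar>u x\<bar> powr (\<alpha> + \<beta>))"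
    and v: "integrable lebesgue (\<lambda>x. \<bar>v x\<bar> powr (\<alpha> + \<beta>))"
  shows "coupling \<alpha> \<beta> u v \<le> d powr (\<alpha> + \<beta>) * Lp_pow (\<alpha> + \<beta>) u
           + d powr (- (\<alpha> / \<beta>) * (\<alpha> + \<beta>)) * Lp_pow (\<alpha> + \<beta>) v"
proof -
  let ?q = "\<alpha> + \<beta>"
  have "coupling \<alpha> \<beta> u v \<le>
      (\<integral>x. d powr ?q * \<bar>u x\<bar> powr ?q + d powr (- (\<alpha> / \<beta>) * ?q) * \<bar>v x\<bar> powr ?q \<partial>lebesgue)"
    unfolding coupling_def
  proof (rule integral_mono')
    fix x
    let ?e = "d powr (- (\<alpha> / \<beta>))"
    have "d powr \<alpha> * ?e powr \<beta> = 1"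
      using ab d by (simp add: powr_powr flip: powr_add)
    then have "\<bar>u x\<bar> powr \<alpha> * \<bar>v x\<bar> powr \<beta> = (d powr \<alpha> * ?e powr \<beta>) * (\<bar>u x\<bar> powr \<alpha> * \<bar>v x\<bar> powr \<beta>)"
      by simp
    also have "\<dots> = (d * \<bar>u x\<bar>) powr \<alpha> * (?e * \<bar>v x\<bar>) powr \<beta>"
      using d by (simp add: powr_mult)
    also have "\<dots> \<le> (d * \<bar>u x\<bar>) powr ?q + (?e * \<bar>v x\<bar>) powr ?q"
      using d ab by (intro powr_mult_powr_le) auto
    also have "\<dots> = d powr ?q * \<bar>u x\<bar> powr ?q + d powr (- (\<alpha> / \<beta>) * ?q) * \<bar>v x\<bar> powr ?q"
      using d by (simp only: powr_mult powr_powr abs_ge_zero less_imp_le powr_ge_zero)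
    finally show "\<bar>u x\<bar> powr \<alpha> * \<bar>v x\<bar> powr \<beta>
        \<le> d powr ?q * \<bar>u x\<bar> powr ?q + d powr (- (\<alpha> / \<beta>) * ?q) * \<bar>v x\<bar> powr ?q" .
  qed (use u v in auto)
  also have "\<dots> = d powr ?q * Lp_pow ?q u + d powr (- (\<alpha> / \<beta>) * ?q) * Lp_pow ?q v"
    using u v by (simp add: Lp_pow_def)
  finally show ?thesis .
qed

lemma tendsto_powr_at_right_0: "e > 0 \<Longrightarrow> ((\<lambda>x::real. x powr e) \<longlongrightarrow> 0) (at_right 0)"
  by (rule tendsto_zero_powrI[OF _ tendsto_const]) (auto simp: eventually_at_filter)

lemma coupling_dilate_tendsto_0:
  fixes u v :: "real^'n::finite \<Rightarrow> real"
  assumes ab: "\<alpha> > 0" "\<beta> > 0" "\<alpha> + \<beta> > 2" and c: "c > 0"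
    and v: "v \<in> borel_measurable lebesgue"
    and iu: "integrable lebesgue (\<lambda>x. \<bar>u x\<bar> powr (\<alpha> + \<beta>))"
    and iv: "integrable lebesgue (\<lambda>x. \<bar>v x\<bar> powr (\<alpha> + \<beta>))"
  shows "((\<lambda>t. coupling \<alpha> \<beta> u (dilate c t v)) \<longlongrightarrow> 0) (at_right 0)"
proof (rule tendsto_sandwich[OF _ _ tendsto_const])
  let ?q = "\<alpha> + \<beta>" and ?g = "gamma_ab TYPE('n) \<alpha> \<beta>"
  \<comment> \<open>Take the weight d = t^k in \<open>coupling_le\<close>. Dilation gives the v-term
    a factor t^?g, and this k is chosen so that the weight costs it exactly t^(-?g/2). Both terms
    then carry positive powers of t.\<close>
  define k where "k = ?g * \<beta> / (2 * ?q * \<alpha>)"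
  let ?R = "\<lambda>t. t powr (k * ?q) * Lp_pow ?q u + t powr (?g / 2) * (c powr ?q * Lp_pow ?q v)"
  have g: "?g > 0" using ab by (simp add: gamma_ab_def)
  then have k: "k > 0" using ab by (simp add: k_def)
  show "eventually (\<lambda>t. 0 \<le> coupling \<alpha> \<beta> u (dilate c t v)) (at_right 0)"
    by (simp add: coupling_nonneg)
  have "coupling \<alpha> \<beta> u (dilate c t v) \<le> ?R t" if t: "t > 0" for t
  proof -
    have "coupling \<alpha> \<beta> u (dilate c t v) \<le> (t powr k) powr ?q * Lp_pow ?q u
       + (t powr k) powr (- (\<alpha> / \<beta>) * ?q) * Lp_pow ?q (dilate c t v)"
      using t by (intro coupling_le ab iu Lp_pow_integrable_dilate v c iv) auto
    also have "\<dots> = t powr (k * ?q) * Lp_pow ?q u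
       + t powr (k * (- (\<alpha> / \<beta>) * ?q) + (real CARD('n) * ?q / 2 - real CARD('n))) * (c powr ?q * Lp_pow ?q v)"
      unfolding Lp_pow_dilate[OF v c t] powr_powr
        powr_add[of t "k * (- (\<alpha> / \<beta>) * ?q)" "real CARD('n) * ?q / 2 - real CARD('n)"]
      by (simp only: mult_ac)
    also have "k * (- (\<alpha> / \<beta>) * ?q) + (real CARD('n) * ?q / 2 - real CARD('n)) = ?g / 2"
    proof -
      have "G * \<beta> / (2 * q * \<alpha>) * (- (\<alpha> / \<beta>) * q) = - G / 2"
        if "q \<noteq> 0" for G q :: real
        using ab that by (simp add: field_simps)
      from this[of ?q ?g] have "k * (- (\<alpha> / \<beta>) * ?q) = - ?g / 2"
        using ab unfolding k_def by simp
      moreover have "real CARD('n) * ?q / 2 - real CARD('n) = ?g"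
        by (simp add: gamma_ab_def field_simps)
      ultimately show ?thesis by (simp only: minus_divide_left[symmetric])
    qed
    finally show ?thesis .
  qed
  then show "eventually (\<lambda>t. coupling \<alpha> \<beta> u (dilate c t v) \<le> ?R t) (at_right 0)"
    by (simp add: eventually_at_filter)
  have "(?R \<longlongrightarrow> 0 * Lp_pow ?q u + 0 * (c powr ?q * Lp_pow ?q v)) (at_right 0)"
    using g k ab by (intro tendsto_intros tendsto_powr_at_right_0) auto
  then show "(?R \<longlongrightarrow> 0) (at_right 0)" by simp
qed

text \<open>Pointwise, |u|^q is at most |u|^2 where |u| is at most 1, and at most |u|^p
  elsewhere.\<close>

lemma integrable_powr_interpolate:
  fixes u :: "real^'n::finite \<Rightarrow> real"
  assumes u: "L2 u" and ip: "integrable lebesgue (\<lambda>x. \<bar>u x\<bar> powr p)" and q: "2 \<le> q" "q \<le> p"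
  shows "integrable lebesgue (\<lambda>x. \<bar>u x\<bar> powr q)"
proof (rule Bochner_Integration.integrable_bound)
  show "integrable lebesgue (\<lambda>x. (u x)\<^sup>2 + \<bar>u x\<bar> powr p)"
    using L2D(2)[OF u] ip by simp
  show "(\<lambda>x. \<bar>u x\<bar> powr q) \<in> borel_measurable lebesgue"
    using L2D(1)[OF u] by auto
  have "\<bar>u x\<bar> powr q \<le> (u x)\<^sup>2 + \<bar>u x\<bar> powr p" for x
  proof (cases "\<bar>u x\<bar> \<le> 1")
    case True
    then have "\<bar>u x\<bar> powr q \<le> \<bar>u x\<bar> powr 2"
      using q(1) by (intro powr_mono') simp_all
    then show ?thesis by (simp add: add_increasing2)
  next
    case False
    then have "\<bar>u x\<bar> powr q \<le> \<bar>u x\<bar> powr p"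
      using q by (intro powr_mono) auto
    then show ?thesis by (simp add: add_increasing)
  qed
  then show "AE x in lebesgue. norm (\<bar>u x\<bar> powr q) \<le> norm ((u x)\<^sup>2 + \<bar>u x\<bar> powr p)"
    by simp
qed

section \<open>Non-attainment\<close>

lemma exponent_facts:
  fixes \<alpha> \<beta> :: real
  assumes card: "CARD('n::finite) = 3 \<or> CARD('n) = 4"
  shows "crit_exp TYPE('n) > 2"
    and "real CARD('n) * crit_exp TYPE('n) / 2 - real CARD('n) = crit_exp TYPE('n)"
    and "1 / 2 - 1 / crit_exp TYPE('n) = 1 / real CARD('n)"
    and "\<alpha> > 1 \<Longrightarrow> \<beta> > 1 \<Longrightarrow> gamma_ab TYPE('n) \<alpha> \<beta> > 0"
    and "\<alpha> + \<beta> < crit_exp TYPE('n) \<Longrightarrow> gamma_ab TYPE('n) \<alpha> \<beta> < crit_exp TYPE('n)"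
  using card by (auto simp: crit_exp_def gamma_ab_def)

text \<open>The constraint eliminates the critical integrals, and 1/2 - 1/2* = 1/N. For \<nu> \<le>
  0 and subcritical \<alpha> + \<beta> the coupling coefficient is nonnegative.\<close>

lemma I_nu_on_Pohozaev:
  fixes u v :: "real^'n::finite \<Rightarrow> real"
  assumes card: "CARD('n) = 3 \<or> CARD('n) = 4"
    and P: "P_nu \<alpha> \<beta> \<nu> u v = 0"
  shows "I_nu \<alpha> \<beta> \<nu> u v = (dirichlet u + dirichlet v) / real CARD('n)
      + (- \<nu>) * (1 - gamma_ab TYPE('n) \<alpha> \<beta> / crit_exp TYPE('n)) * coupling \<alpha> \<beta> u v"
proof -
  let ?c = "crit_exp TYPE('n)" and ?g = "gamma_ab TYPE('n) \<alpha> \<beta>"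
  define D where "D = dirichlet u + dirichlet v"
  define C where "C = coupling \<alpha> \<beta> u v"
  have c: "?c > 2" "1 / real CARD('n) = 1/2 - 1/?c"
    using exponent_facts(1,3)[OF card] by auto
  have L: "Lp_pow ?c u + Lp_pow ?c v = D - \<nu> * ?g * C"
    using P by (simp add: P_nu_def D_def C_def)
  have "I_nu \<alpha> \<beta> \<nu> u v = 1/2 * D - 1/?c * (D - \<nu> * ?g * C) - \<nu> * C"
    unfolding I_nu_def L D_def[symmetric] C_def[symmetric] ..
  also have "\<dots> = D * (1 / real CARD('n)) + (- \<nu>) * (1 - ?g / ?c) * C"
    unfolding c(2) by (simp add: algebra_simps)
  finally show ?thesis by (simp add: D_def C_def)
qed

text \<open>The equation for \<open>d0\<close> says that a rescaled copy of \<open>w\<close> with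
  Dirichlet energy \<open>d0\<close> has critical integral \<open>d0\<close> as well. Such a copy is
  paired with a widely spread one, and a common dilation by a factor close to 1 restores the
  constraint at little cost.\<close>

lemma Pohozaev_competitor:
  fixes w :: "real^'n::finite \<Rightarrow> real"
  assumes card: "CARD('n) = 3 \<or> CARD('n) = 4"
    and ab: "a > 0" "b > 0" and exps: "\<alpha> > 1" "\<beta> > 1" "\<alpha> + \<beta> < crit_exp TYPE('n)"
    and nu: "\<nu> \<le> 0"
    and w: "w \<in> H1" "L2norm w > 0" "Lp_pow (crit_exp TYPE('n)) w > 0"
    and d0: "d0 > 0"
      "Lp_pow (crit_exp TYPE('n)) w / dirichlet w powr (crit_exp TYPE('n) / 2) * d0 powr (crit_exp TYPE('n) / 2) = d0"
    and E: "d0 < E"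
  shows "\<exists>(u, v) \<in> Pohozaev_set \<alpha> \<beta> \<nu> a b.
    I_nu \<alpha> \<beta> \<nu> u (v :: real^'n \<Rightarrow> real) < E / real CARD('n)"
proof -
  define p where "p = crit_exp TYPE('n)"
  define g where "g = gamma_ab TYPE('n) \<alpha> \<beta>"
  define N where "N = real CARD('n)"
  define D where "D = dirichlet w"
  define L where "L = Lp_pow p w"
  have p: "p > 2" "N * p / 2 - N = p" and g: "0 < g" "g < p"
    using exponent_facts(1,2)[OF card] exponent_facts(4,5)[OF card, of \<alpha> \<beta>] exps by (auto simp: p_def g_def N_def)
  have N: "N > 0" using card by (auto simp: N_def)
  have D: "D > 0" unfolding D_def by (rule dirichlet_pos[OF w(1,2)])
  have L: "L > 0" using w(3) by (simp add: L_def p_def)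
  have wL: "L2 w" and wm: "w \<in> borel_measurable lebesgue"
    using H1_L2[OF w(1)] by (auto dest: L2D)
  \<comment> \<open>The Bochner integral of a non-integrable function is 0, so \<open>L > 0\<close> forces integrability.\<close>
  have "integrable lebesgue (\<lambda>x. \<bar>w x\<bar> powr p)"
    using L not_integrable_integral_eq[of lebesgue "\<lambda>x. \<bar>w x\<bar> powr p"] by (auto simp: L_def Lp_pow_def)
  then have wi: "integrable lebesgue (\<lambda>x. \<bar>w x\<bar> powr (\<alpha> + \<beta>))"
    by (rule integrable_powr_interpolate[OF wL]) (use exps in \<open>auto simp: p_def\<close>)
  define c1 where "c1 = a / L2norm w"
  define c2 where "c2 = b / L2norm w"
  have c: "c1 > 0" "c2 > 0" using ab w(2) by (auto simp: c1_def c2_def)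
  have cn: "c1 * L2norm w = a" "c2 * L2norm w = b" using w(2) by (auto simp: c1_def c2_def)
  \<comment> \<open>The amplitude \<open>c1\<close> fixes the \<open>L2\<close> norm. Since the
    Dirichlet energy scales by (c1 t1)^2, this dilation sets it to \<open>d0\<close>.\<close>
  define t1 where "t1 = sqrt (d0 / D) / c1"
  have t1: "t1 > 0" using d0 D c by (simp add: t1_def)
  define u0 where "u0 = dilate c1 t1 w"
  have u0: "u0 \<in> H1" "L2norm u0 = a" "dirichlet u0 = d0" "Lp_pow p u0 = d0"
  proof -
    show "u0 \<in> H1" unfolding u0_def by (rule dilate_H1[OF w(1) t1])
    show "L2norm u0 = a" by (simp add: u0_def L2norm_dilate[OF wm c(1) t1] cn)
    have ct: "c1 * t1 = sqrt (d0 / D)" using c by (simp add: t1_def)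
    have "c1\<^sup>2 * t1\<^sup>2 = (c1 * t1)\<^sup>2" by (simp add: power_mult_distrib)
    also have "\<dots> = d0 / D" using d0 D by (simp add: ct)
    finally show "dirichlet u0 = d0"
      using D by (simp add: u0_def dilate_H1(2)[OF w(1) t1] flip: D_def)
    have "Lp_pow p u0 = (c1 * t1) powr p * L"
      using c t1 p(2) by (simp add: u0_def Lp_pow_dilate[OF wm c(1) t1] L_def powr_mult N_def)
    also have "(c1 * t1) powr p = (d0 / D) powr (p / 2)"
      using d0 D by (simp add: ct powr_powr flip: powr_half_sqrt)
    also have "\<dots> * L = d0"
      using d0 D by (simp add: powr_divide L_def D_def p_def field_simps)
    finally show "Lp_pow p u0 = d0" .
  qed
  \<comment> \<open>The second component spreads out as \<open>t \<rightarrow> 0\<close>.\<close>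
  define v0 where "v0 = (\<lambda>t. dilate c2 t w)"
  define e where "e = (\<lambda>t. (c2 * t)\<^sup>2 * D)"
  define l where "l = (\<lambda>t. (c2 * t) powr p * L)"
  define C where "C = (\<lambda>t. coupling \<alpha> \<beta> u0 (v0 t))"
  have v0: "v0 t \<in> H1" "L2norm (v0 t) = b" "dirichlet (v0 t) = e t" "Lp_pow p (v0 t) = l t"
    if t: "t > 0" for t
  proof -
    show "v0 t \<in> H1" unfolding v0_def by (rule dilate_H1[OF w(1) t])
    show "L2norm (v0 t) = b" by (simp add: v0_def L2norm_dilate[OF wm c(2) t] cn)
    show "dirichlet (v0 t) = e t"
      by (simp add: v0_def dilate_H1(2)[OF w(1) t] e_def D_def power_mult_distrib)
    show "Lp_pow p (v0 t) = l t"
      using c t p(2) by (simp add: v0_def Lp_pow_dilate[OF wm c(2) t] l_def L_def powr_mult N_def)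
  qed
  have Cnn: "C t \<ge> 0" for t by (simp add: C_def coupling_nonneg)
  have C0: "(C \<longlongrightarrow> 0) (at_right 0)"
    unfolding C_def v0_def u0_def
    using exps by (intro coupling_dilate_tendsto_0 c wm wi Lp_pow_integrable_dilate[OF wm c(1) t1]) auto
  have lin: "((\<lambda>t. c2 * t) \<longlongrightarrow> 0) (at_right 0)"
    by (auto intro!: tendsto_eq_intros)
  have pow0: "((\<lambda>t. (c2 * t) powr r) \<longlongrightarrow> 0) (at_right 0)" if "r > 0" for r
    using c that by (intro tendsto_zero_powrI[OF lin tendsto_const]) (auto simp: eventually_at_filter)
  have e0: "(e \<longlongrightarrow> 0) (at_right 0)"
    unfolding e_def by (rule tendsto_eq_intros lin | simp)+
  have l0: "(l \<longlongrightarrow> 0) (at_right 0)"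
    unfolding l_def using p by (intro tendsto_mult_left_zero pow0) simp
  \<comment> \<open>Here \<sigma>^2 is the midpoint of 1 and E/d0, so dilating by \<sigma> strictly
    raises the energy \<open>d0\<close> yet keeps it below \<open>E\<close>.\<close>
  define \<sigma> where "\<sigma> = sqrt ((1 + E / d0) / 2)"
  have "1 < (1 + E / d0) / 2" using E d0 by (simp add: field_simps)
  then have \<sigma>: "\<sigma> > 1" "\<sigma>\<^sup>2 * d0 < E"
    using E d0 by (auto simp: \<sigma>_def field_simps)
  \<comment> \<open>This is \<open>P_nu\<close> of the pair dilated by \<sigma>. Its limit as t
    tends to 0 is (\<sigma>^2 - \<sigma>^p) d0, which is negative because p > 2.\<close>
  have "((\<lambda>t. \<sigma>\<^sup>2 * (d0 + e t) - \<sigma> powr p * (d0 + l t) + (- \<nu>) * g * \<sigma> powr g * C t)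
      \<longlongrightarrow> \<sigma>\<^sup>2 * (d0 + 0) - \<sigma> powr p * (d0 + 0) + (- \<nu>) * g * \<sigma> powr g * 0) (at_right 0)"
    by (intro tendsto_intros e0 l0 C0)
  moreover have "\<sigma>\<^sup>2 * (d0 + 0) - \<sigma> powr p * (d0 + 0) + (- \<nu>) * g * \<sigma> powr g * 0 < 0"
  proof -
    have "\<sigma> powr 2 < \<sigma> powr p" using \<sigma> p by (intro powr_less_mono) auto
    then show ?thesis using \<sigma> d0 by simp
  qed
  ultimately have ev1: "eventually (\<lambda>t. \<sigma>\<^sup>2 * (d0 + e t) - \<sigma> powr p * (d0 + l t) + (- \<nu>) * g * \<sigma> powr g * C t < 0) (at_right 0)"
    by (rule order_tendstoD)
  \<comment> \<open>This is N times the bound that will dominate the energy for every dilation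
    factor in [1, \<sigma>].\<close>
  have "((\<lambda>t. \<sigma>\<^sup>2 * (d0 + e t) + (- \<nu>) * N * \<sigma> powr g * C t)
      \<longlongrightarrow> \<sigma>\<^sup>2 * (d0 + 0) + (- \<nu>) * N * \<sigma> powr g * 0) (at_right 0)"
    by (intro tendsto_intros e0 C0)
  then have ev2: "eventually (\<lambda>t. \<sigma>\<^sup>2 * (d0 + e t) + (- \<nu>) * N * \<sigma> powr g * C t < E) (at_right 0)"
    by (rule order_tendstoD) (use \<sigma> in simp)
  \<comment> \<open>This comparison makes l t at most e t for small t, the critical integral being
    of higher order in t than the Dirichlet energy.\<close>
  have "((\<lambda>t. (c2 * t) powr (p - 2) * L) \<longlongrightarrow> 0) (at_right 0)"
    using p by (intro tendsto_mult_left_zero pow0) simp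
  then have ev3: "eventually (\<lambda>t. (c2 * t) powr (p - 2) * L < D) (at_right 0)"
    using D by (rule order_tendstoD)
  have ev4: "eventually (\<lambda>t. t > 0) (at_right (0::real))"
    by (simp add: eventually_at_filter)
  obtain t where t: "t > 0" "(c2 * t) powr (p - 2) * L < D"
    and t1': "\<sigma>\<^sup>2 * (d0 + e t) - \<sigma> powr p * (d0 + l t) + (- \<nu>) * g * \<sigma> powr g * C t < 0"
    and t2: "\<sigma>\<^sup>2 * (d0 + e t) + (- \<nu>) * N * \<sigma> powr g * C t < E"
    using eventually_happens[OF eventually_conj[OF eventually_conj[OF ev1 ev2] eventually_conj[OF ev3 ev4]]]
    by (auto simp: trivial_limit_at_right_real)
  have "l t \<le> e t"
  proof -
    have "l t = (c2 * t)\<^sup>2 * ((c2 * t) powr (p - 2) * L)"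
      using c t by (simp add: l_def powr_diff)
    also have "\<dots> \<le> (c2 * t)\<^sup>2 * D" using t by (intro mult_left_mono) auto
    finally show ?thesis by (simp add: e_def)
  qed
  \<comment> \<open>This is \<open>P_nu\<close> along the common dilation by s. It is nonnegative at
    1, since l t \<le> e t and \<nu> \<le> 0, and negative at \<sigma>, so it has a zero in
    between.\<close>
  define f where "f = (\<lambda>s. s\<^sup>2 * (d0 + e t) - s powr p * (d0 + l t) + (- \<nu>) * g * s powr g * C t)"
  have "\<nu> * g * C t \<le> 0" using nu g Cnn[of t] by (simp add: mult_nonpos_nonneg)
  then have "f 1 \<ge> 0" using \<open>l t \<le> e t\<close> by (simp add: f_def)
  moreover have "f \<sigma> \<le> 0" using t1' by (simp add: f_def)
  moreover have "continuous_on {1..\<sigma>} f"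
    unfolding f_def by (intro continuous_intros) auto
  ultimately obtain s where s: "1 \<le> s" "s \<le> \<sigma>" "f s = 0"
    using IVT2'[of f \<sigma> 0 1] \<sigma> by auto
  have s0: "s > 0" using s by simp
  define u where "u = dilate 1 s u0"
  define v where "v = dilate 1 s (v0 t)"
  have m: "u0 \<in> borel_measurable lebesgue" "v0 t \<in> borel_measurable lebesgue"
    using H1_L2[OF u0(1)] H1_L2[OF v0(1)[OF t(1)]] by (auto dest: L2D)
  have D': "dirichlet u + dirichlet v = s\<^sup>2 * (d0 + e t)"
    using dilate_H1(2)[OF u0(1) s0, of 1] dilate_H1(2)[OF v0(1)[OF t(1)] s0, of 1] u0(3) v0(3)[OF t(1)]
    by (simp add: u_def v_def distrib_left)
  have L': "Lp_pow p u + Lp_pow p v = s powr p * (d0 + l t)"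
    using Lp_pow_dilate[OF m(1) zero_less_one s0, of p] Lp_pow_dilate[OF m(2) zero_less_one s0, of p]
      u0(4) v0(4)[OF t(1)] p(2) by (simp add: u_def v_def distrib_left N_def)
  have C': "coupling \<alpha> \<beta> u v = s powr g * C t"
    using coupling_dilate[OF m s0, of \<alpha> \<beta>] by (simp add: u_def v_def g_def C_def)
  have P: "P_nu \<alpha> \<beta> \<nu> u v = 0"
    using s(3) unfolding P_nu_def D' p_def[symmetric] L' C' g_def[symmetric] by (simp add: f_def)
  have "(u, v) \<in> T_set a b"
    using dilate_H1(1)[OF u0(1) s0, of 1] dilate_H1(1)[OF v0(1)[OF t(1)] s0, of 1] u0(2) v0(2)[OF t(1)]
      L2norm_dilate[OF m(1) zero_less_one s0] L2norm_dilate[OF m(2) zero_less_one s0]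
    by (simp add: T_set_def u_def v_def)
  with P have mem: "(u, v) \<in> Pohozaev_set \<alpha> \<beta> \<nu> a b"
    by (simp add: Pohozaev_set_def)
  have "I_nu \<alpha> \<beta> \<nu> u v = s\<^sup>2 * (d0 + e t) / N + (- \<nu>) * (1 - g / p) * (s powr g * C t)"
    using I_nu_on_Pohozaev[OF card P] unfolding D' C' g_def p_def N_def .
  \<comment> \<open>Every term increases when s is replaced by \<sigma>, and the factor 1 - g/p is
    at most 1. The bound no longer depends on the unknown zero s.\<close>
  also have "\<dots> \<le> \<sigma>\<^sup>2 * (d0 + e t) / N + (- \<nu>) * (\<sigma> powr g * C t)"
  proof (intro add_mono divide_right_mono mult_right_mono)
    show "s\<^sup>2 \<le> \<sigma>\<^sup>2" using s by (intro power_mono) auto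
    show "0 \<le> d0 + e t" using d0 D by (simp add: e_def)
    have "(- \<nu>) * (1 - g / p) * (s powr g * C t) \<le> (- \<nu>) * 1 * (\<sigma> powr g * C t)"
      using s nu g p Cnn[of t] by (intro mult_mono powr_mono2) auto
    then show "(- \<nu>) * (1 - g / p) * (s powr g * C t) \<le> (- \<nu>) * (\<sigma> powr g * C t)" by simp
  qed (use N in auto)
  also have "\<dots> = (\<sigma>\<^sup>2 * (d0 + e t) + (- \<nu>) * N * \<sigma> powr g * C t) / N"
    using N by (simp add: field_simps)
  also have "\<dots> < E / N" using t2 N by (intro divide_strict_right_mono)
  finally show ?thesis using mem unfolding N_def by blast
qed

text \<open>Write z^p = z z^(p-1) and replace each factor z^(p-1) by the strictly larger (x +
  y)^(p-1).\<close>

lemma powr_add_less_powr_add: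
  fixes x y p :: real
  assumes "x > 0" "y > 0" "p > 1"
  shows "x powr p + y powr p < (x + y) powr p"
proof -
  have eq: "z powr p = z * z powr (p - 1)" if "z > 0" for z :: real
    using that powr_add[of z 1 "p - 1"] by simp
  have "x * x powr (p - 1) + y * y powr (p - 1) < x * (x + y) powr (p - 1) + y * (x + y) powr (p - 1)"
    using assms by (intro add_strict_mono mult_strict_left_mono powr_less_mono2) auto
  then show ?thesis
    using assms by (simp add: eq distrib_right)
qed

text \<open>With x and y the two Dirichlet energies and p half the critical exponent,
  superadditivity gives K (x + y)^(p-1) > 1, while the level d satisfies K d^(p-1) = 1. The strict
  gap leaves room for a better competitor.\<close>

lemma scaling_level_less:
  fixes x y K p :: real
  assumes xy: "x > 0" "y > 0" and p: "p > 1" and le: "x + y \<le> K * (x powr p + y powr p)"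
  obtains d where "d > 0" "K * d powr p = d" "d < x + y" "K > 0"
proof -
  have "0 < K * (x powr p + y powr p)" using le xy by linarith
  moreover have "0 < x powr p + y powr p" using xy by (simp add: add_pos_pos)
  ultimately have K: "K > 0" by (simp add: zero_less_mult_iff)
  define d where "d = K powr (- 1 / (p - 1))"
  have "d > 0" using K by (simp add: d_def)
  have dp: "d powr (p - 1) = 1 / K"
  proof -
    have "d powr (p - 1) = K powr (- 1 / (p - 1) * (p - 1))"
      unfolding d_def by (rule powr_powr)
    also have "- 1 / (p - 1) * (p - 1) = - 1" using p by simp
    finally show ?thesis using K by (simp add: powr_minus_divide)
  qed
  have eq: "z powr p = z * z powr (p - 1)" if "z > 0" for z :: real
    using that powr_add[of z 1 "p - 1"] by simp
  have "K * d powr p = d"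
    using K \<open>d > 0\<close> by (simp add: eq dp)
  have "x + y < K * (x + y) powr p"
    using le mult_strict_left_mono[OF powr_add_less_powr_add[OF xy p] K] by linarith
  also have "\<dots> = (x + y) * (K * (x + y) powr (p - 1))"
    using xy by (simp add: eq[of "x + y"])
  finally have "1 < K * (x + y) powr (p - 1)"
    using xy by (simp add: mult_less_cancel_left1)
  then have "d powr (p - 1) < (x + y) powr (p - 1)"
    using K by (simp add: dp field_simps)
  then have "d < x + y"
    using p xy powr_mono2[of "p - 1" "x + y" d] by linarith
  with K \<open>d > 0\<close> \<open>K * d powr p = d\<close> that show thesis by blast
qed

theorem theorem1p1:
  fixes a b \<alpha> \<beta> \<nu> :: real
  assumes "CARD('n::finite) = 3 \<or> CARD('n) = 4"
    and "a > 0" and "b > 0"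
    and "\<alpha> > 1" and "\<beta> > 1" and "\<alpha> + \<beta> < crit_exp TYPE('n)"
    and "\<nu> \<le> 0"
  shows "\<not> (\<exists>(u, v) \<in> (Pohozaev_set \<alpha> \<beta> \<nu> a b :: ((real^'n \<Rightarrow> real) \<times> (real^'n \<Rightarrow> real)) set).
            ereal (I_nu \<alpha> \<beta> \<nu> u v) = m_nu TYPE('n) \<alpha> \<beta> \<nu> a b)"
proof
  note card = assms(1)
  let ?S = "Pohozaev_set \<alpha> \<beta> \<nu> a b :: ((real^'n \<Rightarrow> real) \<times> (real^'n \<Rightarrow> real)) set"
  define p where "p = crit_exp TYPE('n)"
  define g where "g = gamma_ab TYPE('n) \<alpha> \<beta>"
  have p: "p > 2" and g: "0 < g" "g < p"
    using exponent_facts(1)[OF card] exponent_facts(4,5)[OF card, of \<alpha> \<beta>] assms by (auto simp: p_def g_def)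
  assume "\<exists>(u, v) \<in> ?S. ereal (I_nu \<alpha> \<beta> \<nu> u v) = m_nu TYPE('n) \<alpha> \<beta> \<nu> a b"
  then obtain u v where uv: "(u, v) \<in> ?S" and min: "ereal (I_nu \<alpha> \<beta> \<nu> u v) = m_nu TYPE('n) \<alpha> \<beta> \<nu> a b"
    by blast
  have H: "u \<in> H1" "v \<in> H1" "L2norm u > 0" "L2norm v > 0" and P: "P_nu \<alpha> \<beta> \<nu> u v = 0"
    using uv assms(2,3) by (auto simp: Pohozaev_set_def T_set_def)
  note D = dirichlet_pos[OF H(1,3)] dirichlet_pos[OF H(2,4)]
  define K where "K = (\<lambda>w :: real^'n \<Rightarrow> real. Lp_pow p w / dirichlet w powr (p / 2))"
  have LK: "Lp_pow p w = K w * dirichlet w powr (p / 2)" if "dirichlet w > 0" for w :: "real^'n \<Rightarrow> real"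
    using that by (simp add: K_def)
  \<comment> \<open>Bounding both quotients by the larger one gives a single constant for both
    components, and this constant is realised by an actual function from which competitors can be
    built.\<close>
  obtain w where w: "w = u \<or> w = v" "K u \<le> K w" "K v \<le> K w"
    by (cases "K u \<le> K v") auto
  have "\<nu> * g * coupling \<alpha> \<beta> u v \<le> 0"
    using assms(7) g coupling_nonneg[of \<alpha> \<beta> u v] by (simp add: mult_nonpos_nonneg)
  then have "dirichlet u + dirichlet v \<le> Lp_pow p u + Lp_pow p v"
    using P by (simp add: P_nu_def p_def g_def)
  also have "\<dots> \<le> K w * dirichlet u powr (p / 2) + K w * dirichlet v powr (p / 2)"
    using w D by (intro add_mono) (simp_all add: LK mult_right_mono)
  also have "\<dots> = K w * (dirichlet u powr (p / 2) + dirichlet v powr (p / 2))"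
    by (simp add: distrib_left)
  finally obtain d where d: "d > 0" "K w * d powr (p / 2) = d" "d < dirichlet u + dirichlet v" "K w > 0"
    using scaling_level_less[OF D, of "p / 2" "K w"] p by auto
  have wH: "w \<in> H1" "L2norm w > 0" "dirichlet w > 0" using w H D by auto
  have wL: "Lp_pow p w > 0" using LK[OF wH(3)] d(4) wH(3) by simp
  obtain u' v' where uv': "(u', v') \<in> ?S"
    and less: "I_nu \<alpha> \<beta> \<nu> u' v' < (dirichlet u + dirichlet v) / real CARD('n)"
    using Pohozaev_competitor[OF assms wH(1,2) wL[unfolded p_def] d(1) d(2)[unfolded K_def p_def] d(3)]
    by blast
  have "m_nu TYPE('n) \<alpha> \<beta> \<nu> a b \<le> ereal (I_nu \<alpha> \<beta> \<nu> u' v')"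
    unfolding m_nu_def by (rule INF_lower2[OF uv']) simp
  then have "I_nu \<alpha> \<beta> \<nu> u v \<le> I_nu \<alpha> \<beta> \<nu> u' v'"
    by (simp flip: min)
  \<comment> \<open>Discarding the nonnegative coupling term leaves a lower bound for the energy of
    the supposed minimizer, which the competitor lies strictly below.\<close>
  moreover have "(dirichlet u + dirichlet v) / real CARD('n) \<le> I_nu \<alpha> \<beta> \<nu> u v"
    using I_nu_on_Pohozaev[OF card P] assms(7) g p coupling_nonneg[of \<alpha> \<beta> u v]
    by (simp add: mult_nonpos_nonneg p_def g_def)
  ultimately show False using less by simp
qed

end
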